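(* Let $b_{-4}(t,\eta,\xi)$ be the even part (in each $\xi_j$) of $\mathrm{tr}(\sigma_{-4}(x,\xi))$, where $\sigma_{-4}$ is the order $-4$ term of the symbol of the parametrix of $D^2$ for the Robertson-Walker metric with scale factor $a(t)$, which computes the $a_2$ term of the heat kernel expansion of $D^2$. Perform the change of variables $$u_0=\sin^2\eta,\quad u_1=\xi_1,\quad u_2=\xi_2,\quad u_3=\csc(\eta)\,\xi_3,\quad u_4=\sec(\eta)\,\xi_4,$$ and write $\alpha=a(t)$, $\alpha_1=a'(t)$, $\alpha_2=a''(t)$, regarded as independent affine variables $\alpha\in\mathbb G_m$, $(\alpha_1,\alpha_2)\in\mathbb A^2$. Then the form $b_{-4}\, d\eta\wedge\sigma_{\xi,3}$, with $\sigma_{\xi,3}=\sum_{j=1}^4(-1)^{j-1}\xi_j\,d\xi_1\wedge\cdots\wedge\widehat{d\xi_j}\wedge\cdots\wedge d\xi_4$, is a rational differential form $$\Omega=f\,\widetilde\sigma_3$$ in the affine coordinates $(u_0,u_1,u_2,u_3,u_4)\in\mathbb A^5$, $\alpha\in\mathbb G_m$, $(\alpha_1,\alpha_2)\in\mathbb A^2$, where $f=f_{(\alpha_1,\alpha_2)}(u_0,\dots,u_4,\alpha)$ is a $\mathbb Q$-linear combination of rational functions of the form $$\frac{P(u_0,u_1,u_2,u_3,u_4,\alpha,\alpha_1,\alpha_2)}{\alpha^{2r}u_0^k(1-u_0)^m\big(u_1^2+\alpha^{-2}(u_2^2+u_3^2+u_4^2)\big)^\ell}$$ with $P\in\mathbb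 Q[u_0,u_1,u_2,u_3,u_4,\alpha,\alpha_1,\alpha_2]$ and $r,k,m,\ell$ non-negative integers, and $$\widetilde\sigma_3=\tfrac12\big(u_1\,du_0du_2du_3du_4-u_2\,du_0du_1du_3du_4+u_3\,du_0du_1du_2du_4-u_4\,du_0du_1du_2du_3\big).$$ Moreover, for a fixed $\alpha\in\mathbb Q\smallsetminus\{0\}$, the restrictions $\Omega^\alpha_{(\alpha_1,\alpha_2)}$, $(\alpha_1,\alpha_2)\in\mathbb Q^2$, are a two-parameter family of algebraic differential forms on the algebraic variety over $\mathbb Q$ given by the complement in $\mathbb A^5$ of the union of the hyperplanes $H_0=\{u_0=0\}$, $H_1=\{u_0=1\}$ and the hypersurface $\widehat{CZ}_\alpha$ defined by the vanishing of the quadratic form $Q_{\alpha,2}=u_1^2+\alpha^{-2}(u_2^2+u_3^2+u_4^2)$.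
   Context: Setting. Let $a(t)>0$ be a smooth function and consider the (Euclidean) Robertson-Walker metric $ds^2=dt^2+a(t)^2d\sigma^2$, with $d\sigma^2$ the round metric on $\mathbb S^3$, in Hopf coordinates $x=(x_1,x_2,x_3,x_4)=(t,\eta,\phi_1,\phi_2)$, $0<\eta<\pi/2$, $0<\phi_1,\phi_2<2\pi$: $ds^2=dt^2+a(t)^2(d\eta^2+\sin^2\eta\,d\phi_1^2+\cos^2\eta\,d\phi_2^2)$. In a local trivialization of the spinor bundle the Dirac operator $D$ has symbol $q_1+q_0$, with $q_1=\begin{pmatrix}0&A_1\\ B_1&0\end{pmatrix}$, $q_0=\begin{pmatrix}0&A_0\\ B_0&0\end{pmatrix}$ in $2\times2$ blocks, where (with $a=a(t)$) $$A_1=\begin{pmatrix}\frac{i\sec\eta\,\xi_4}{a}-\xi_1&\frac{i\xi_2+\csc\eta\,\xi_3}{a}\\ \frac{i\xi_2-\csc\eta\,\xi_3}{a}&-\xi_1-\frac{i\sec\eta\,\xi_4}{a}\end{pmatrix},\quad B_1=\begin{pmatrix}-\xi_1-\frac{i\sec\eta\,\xi_4}{a}&\frac{-i\xi_2-\csc\eta\,\xi_3}{a}\\ \frac{\csc\eta\,\xi_3-i\xi_2}{a}&\frac{i\sec\eta\,\xi_4}{a}-\xi_1\end{pmatrix},$$ $$A_0=\begin{pmatrix}\frac{3ia'}{2a}&\frac{\cot\eta-\tan\eta}{2a}\\ \frac{\cot\eta-\tan\eta}{2a}&\frac{3ia'}{2a}\end{pmatrix},\quad B_0=\begin{pmatrix}\frac{3ia'}{2a}&\frac{\tan\eta-\cot\eta}{2a}\\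 \frac{\tan\eta-\cot\eta}{2a}&\frac{3ia'}{2a}\end{pmatrix}.$$ The symbol of $D^2$ is $p_2+p_1+p_0$ with $p_2=q_1^2=\big(\xi_1^2+\frac{\xi_2^2+\csc^2\eta\,\xi_3^2+\sec^2\eta\,\xi_4^2}{a^2}\big)I_4$, $p_1=q_0q_1+q_1q_0-i\sum_j\partial_{\xi_j}q_1\,\partial_{x_j}q_1$, $p_0=q_0^2-i\sum_j\partial_{\xi_j}q_1\,\partial_{x_j}q_0$. Parametrix. The homogeneous terms $\sigma_{-2-N}$ (of order $-2-N$ in $\xi$) of the symbol of the parametrix $(D^2)^{-1}$ are $\sigma_{-2}=p_2^{-1}$ and, for $N>0$, $$\sigma_{-2-N}=-\Big(\sum\frac{(-i)^{|\beta|}}{\beta!}(\partial_\xi^\beta\sigma_{-2-j})(\partial_x^\beta p_k)\Big)\sigma_{-2},$$ the sum being over $0\le j<N$, $0\le k\le2$, $\beta\in\mathbb Z_{\ge0}^4$ with $-2-j-|\beta|+k=-N$. The function $b_{-4}(t,\eta,\xi)$ is obtained from $\mathrm{tr}(\sigma_{-4}(x,\xi))$ (written as a sum of terms, each a monomial in $\xi_1,\dots,\xi_4$ times a function of $(t,\eta)$, divided by a power of $\xi_1^2+\frac{\xi_2^2+\csc^2\eta\,\xi_3^2+\sec^2\eta\,\xi_4^2}{a^2}$) by deleting all terms with an odd power of some $\xi_j$ in the numerator; i.e. it is the part of $\mathrm{tr}(\sigma_{-4})$ that is even in each $\xi_j$. It does not depend on $\phi_1,\phi_2$. An algebraic differential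 form on a variety over $\mathbb Q$ means a regular differential form defined over $\mathbb Q$. *)

theory Defs
  imports "HOL-Analysis.Analysis" "HOL-Library.Poly_Mapping"
begin

section \<open>Symbols\<close>

text \<open>
  The local coordinates are \<open>x = (t, \<eta>, \<phi>1, \<phi>2)\<close>, that is \<open>x $ 1 = t\<close>, \<open>x $ 2 = \<eta>\<close>, and so on;
  the cotangent coordinates are \<open>\<xi> $ 1, \<dots>, \<xi> $ 4\<close>. In the index type \<open>4\<close> the element \<open>4\<close> is \<open>0\<close>.
  Symbols take values in 4 by 4 complex matrices, indexed by \<open>2 + 2\<close> to display their 2 by 2 blocks.
\<close>

type_synonym symbol = "real^4 \<Rightarrow> real^4 \<Rightarrow> complex^(2 + 2)^(2 + 2)"

definition off_diag :: "complex^2^2 \<Rightarrow> complex^2^2 \<Rightarrow> complex^(2 + 2)^(2 + 2)" where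
  "off_diag A B = (\<chi> i j. case (i, j) of
       (Inl k, Inr l) \<Rightarrow> A $ k $ l
     | (Inr k, Inl l) \<Rightarrow> B $ k $ l
     | _ \<Rightarrow> 0)"

definition cscale :: "complex \<Rightarrow> complex^'n^'m \<Rightarrow> complex^'n^'m" where
  "cscale c M = (\<chi> i j. c * M $ i $ j)"

definition csc :: "real \<Rightarrow> real" where "csc \<eta> = 1 / sin \<eta>"

definition sec :: "real \<Rightarrow> real" where "sec \<eta> = 1 / cos \<eta>"

definition A1 :: "(real \<Rightarrow> real) \<Rightarrow> real^4 \<Rightarrow> real^4 \<Rightarrow> complex^2^2" where
  "A1 a x \<xi> = vector
    [vector [\<i> * sec (x $ 2) * \<xi> $ 4 / a (x $ 1) - \<xi> $ 1,
             (\<i> * \<xi> $ 2 + csc (x $ 2) * \<xi> $ 3) / a (x $ 1)],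
     vector [(\<i> * \<xi> $ 2 - csc (x $ 2) * \<xi> $ 3) / a (x $ 1),
             - \<xi> $ 1 - \<i> * sec (x $ 2) * \<xi> $ 4 / a (x $ 1)]]"

definition B1 :: "(real \<Rightarrow> real) \<Rightarrow> real^4 \<Rightarrow> real^4 \<Rightarrow> complex^2^2" where
  "B1 a x \<xi> = vector
    [vector [- \<xi> $ 1 - \<i> * sec (x $ 2) * \<xi> $ 4 / a (x $ 1),
             (- \<i> * \<xi> $ 2 - csc (x $ 2) * \<xi> $ 3) / a (x $ 1)],
     vector [(csc (x $ 2) * \<xi> $ 3 - \<i> * \<xi> $ 2) / a (x $ 1),
             \<i> * sec (x $ 2) * \<xi> $ 4 / a (x $ 1) - \<xi> $ 1]]"

definition A0 :: "(real \<Rightarrow> real) \<Rightarrow> real^4 \<Rightarrow> complex^2^2" where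
  "A0 a x = vector
    [vector [3 * \<i> * deriv a (x $ 1) / (2 * a (x $ 1)),
             complex_of_real ((cot (x $ 2) - tan (x $ 2)) / (2 * a (x $ 1)))],
     vector [complex_of_real ((cot (x $ 2) - tan (x $ 2)) / (2 * a (x $ 1))),
             3 * \<i> * deriv a (x $ 1) / (2 * a (x $ 1))]]"

definition B0 :: "(real \<Rightarrow> real) \<Rightarrow> real^4 \<Rightarrow> complex^2^2" where
  "B0 a x = vector
    [vector [3 * \<i> * deriv a (x $ 1) / (2 * a (x $ 1)),
             complex_of_real ((tan (x $ 2) - cot (x $ 2)) / (2 * a (x $ 1)))],
     vector [complex_of_real ((tan (x $ 2) - cot (x $ 2)) / (2 * a (x $ 1))),
             3 * \<i> * deriv a (x $ 1) / (2 * a (x $ 1))]]"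

definition q1 :: "(real \<Rightarrow> real) \<Rightarrow> symbol" where
  "q1 a = (\<lambda>x \<xi>. off_diag (A1 a x \<xi>) (B1 a x \<xi>))"

definition q0 :: "(real \<Rightarrow> real) \<Rightarrow> symbol" where
  "q0 a = (\<lambda>x \<xi>. off_diag (A0 a x) (B0 a x))"

definition pd_x :: "4 \<Rightarrow> symbol \<Rightarrow> symbol" where
  "pd_x j s = (\<lambda>x \<xi>. vector_derivative (\<lambda>h. s (x + h *\<^sub>R axis j 1) \<xi>) (at 0))"

definition pd_xi :: "4 \<Rightarrow> symbol \<Rightarrow> symbol" where
  "pd_xi j s = (\<lambda>x \<xi>. vector_derivative (\<lambda>h. s x (\<xi> + h *\<^sub>R axis j 1)) (at 0))"

definition mpd_x :: "nat^4 \<Rightarrow> symbol \<Rightarrow> symbol" where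
  "mpd_x \<beta> s = (pd_x 1 ^^ (\<beta> $ 1)) ((pd_x 2 ^^ (\<beta> $ 2)) ((pd_x 3 ^^ (\<beta> $ 3)) ((pd_x 4 ^^ (\<beta> $ 4)) s)))"

definition mpd_xi :: "nat^4 \<Rightarrow> symbol \<Rightarrow> symbol" where
  "mpd_xi \<beta> s = (pd_xi 1 ^^ (\<beta> $ 1)) ((pd_xi 2 ^^ (\<beta> $ 2)) ((pd_xi 3 ^^ (\<beta> $ 3)) ((pd_xi 4 ^^ (\<beta> $ 4)) s)))"

definition p2 :: "(real \<Rightarrow> real) \<Rightarrow> symbol" where
  "p2 a = (\<lambda>x \<xi>. q1 a x \<xi> ** q1 a x \<xi>)"

definition p1 :: "(real \<Rightarrow> real) \<Rightarrow> symbol" where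
  "p1 a = (\<lambda>x \<xi>. q0 a x \<xi> ** q1 a x \<xi> + q1 a x \<xi> ** q0 a x \<xi>
             - cscale \<i> (\<Sum>j\<in>UNIV. pd_xi j (q1 a) x \<xi> ** pd_x j (q1 a) x \<xi>))"

definition p0 :: "(real \<Rightarrow> real) \<Rightarrow> symbol" where
  "p0 a = (\<lambda>x \<xi>. q0 a x \<xi> ** q0 a x \<xi>
             - cscale \<i> (\<Sum>j\<in>UNIV. pd_xi j (q1 a) x \<xi> ** pd_x j (q0 a) x \<xi>))"

text \<open>The homogeneous term of order \<open>k\<close> of the symbol of the square of the Dirac operator.\<close>

definition dirac_sq_symbol :: "(real \<Rightarrow> real) \<Rightarrow> nat \<Rightarrow> symbol" where
  "dirac_sq_symbol a k = (if k = 0 then p0 a else if k = 1 then p1 a else if k = 2 then p2 a else (\<lambda>x \<xi>. 0))"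

definition mi_abs :: "nat^4 \<Rightarrow> nat" where
  "mi_abs \<beta> = (\<Sum>i\<in>UNIV. \<beta> $ i)"

definition mi_fact :: "nat^4 \<Rightarrow> nat" where
  "mi_fact \<beta> = (\<Prod>i\<in>UNIV. fact (\<beta> $ i))"

text \<open>
  \<open>parametrix a N\<close> is the term of order \<open>- 2 - N\<close>. The side condition \<open>- 2 - j - |\<beta>| + k = - N\<close> on the
  summation indices is written without subtraction.
\<close>

fun parametrix :: "(real \<Rightarrow> real) \<Rightarrow> nat \<Rightarrow> symbol" where
  "parametrix a N = (\<lambda>x \<xi>.
     if N = 0 then matrix_inv (p2 a x \<xi>)
     else - (\<Sum>j<N. \<Sum>k\<le>2. \<Sum>\<beta> | N + k = 2 + j + mi_abs \<beta>.
               cscale ((- \<i>) ^ mi_abs \<beta> / of_nat (mi_fact \<beta>))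
                 (mpd_xi \<beta> (parametrix a j) x \<xi> ** mpd_x \<beta> (dirac_sq_symbol a k) x \<xi>))
          ** matrix_inv (p2 a x \<xi>))"

declare parametrix.simps [simp del]

definition flip :: "4 \<Rightarrow> real^4 \<Rightarrow> real^4" where
  "flip j \<xi> = (\<chi> i. if i = j then - \<xi> $ i else \<xi> $ i)"

definition even_in :: "4 \<Rightarrow> (real^4 \<Rightarrow> complex) \<Rightarrow> real^4 \<Rightarrow> complex" where
  "even_in j g = (\<lambda>\<xi>. (g \<xi> + g (flip j \<xi>)) / 2)"

text \<open>
  The even part in each \<open>\<xi> $ j\<close>: as \<open>p2\<close> is even in every \<open>\<xi> $ j\<close>, averaging over sign changes deletes
  exactly the terms with an odd power of some \<open>\<xi> $ j\<close> in the numerator.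
\<close>

definition b_minus4 :: "(real \<Rightarrow> real) \<Rightarrow> real^4 \<Rightarrow> real^4 \<Rightarrow> complex" where
  "b_minus4 a x = even_in 1 (even_in 2 (even_in 3 (even_in 4 (\<lambda>\<xi>. trace (parametrix a 2 x \<xi>)))))"

definition smooth_on_open :: "real set \<Rightarrow> (real \<Rightarrow> real) \<Rightarrow> bool" where
  "smooth_on_open I a \<longleftrightarrow> (\<forall>n. \<forall>t\<in>I. (deriv ^^ n) a differentiable (at t))"


section \<open>Differential forms\<close>

text \<open>
  A form of degree \<open>k\<close> maps a point and a list of \<open>k\<close> tangent vectors to a complex number; the forms
  below are built from differentials and wedge products and vanish on lists of any other length.
  On a complex vector space the differential of a holomorphic function is complex linear, so
  the same notions serve for the real source and for the complex points of the target.
\<close>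

type_synonym 'v dform = "'v \<Rightarrow> 'v list \<Rightarrow> complex"

definition differential :: "('v::real_normed_vector \<Rightarrow> complex) \<Rightarrow> 'v dform" where
  "differential \<phi> = (\<lambda>p vs. case vs of [v] \<Rightarrow> frechet_derivative \<phi> (at p) v | _ \<Rightarrow> 0)"

text \<open>
  The wedge product of a 1-form \<open>\<theta>\<close> and a \<open>k\<close>-form \<open>\<omega>\<close>:
  \<open>(\<theta> \<and> \<omega>)(v\<^sub>0, \<dots>, v\<^sub>k) = \<Sum>\<^sub>i (-1)\<^sup>i \<theta>(v\<^sub>i) \<omega>(v\<^sub>0, \<dots>, v\<^sub>i omitted, \<dots>, v\<^sub>k)\<close>.
\<close>

definition wedge1 :: "'v dform \<Rightarrow> 'v dform \<Rightarrow> 'v dform" where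
  "wedge1 \<theta> \<omega> = (\<lambda>p vs. \<Sum>i<length vs.
      (- 1) ^ i * \<theta> p [vs ! i] * \<omega> p (take i vs @ drop (Suc i) vs))"

definition unit_form :: "'v dform" where
  "unit_form = (\<lambda>p vs. if vs = [] then 1 else 0)"

text \<open>\<open>wedge_d [\<phi>\<^sub>1, \<dots>, \<phi>\<^sub>k]\<close> is \<open>d\<phi>\<^sub>1 \<and> \<dots> \<and> d\<phi>\<^sub>k\<close>; \<open>unit_form\<close> is the constant 0-form 1.\<close>

definition wedge_d :: "('v::real_normed_vector \<Rightarrow> complex) list \<Rightarrow> 'v dform" where
  "wedge_d \<phi>s = foldr (\<lambda>\<phi> \<omega>. wedge1 (differential \<phi>) \<omega>) \<phi>s unit_form"

definition pullback ::
    "('v::real_normed_vector \<Rightarrow> 'w::real_normed_vector) \<Rightarrow> 'w dform \<Rightarrow> 'v dform" where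
  "pullback F \<omega> = (\<lambda>p vs. \<omega> (F p) (map (frechet_derivative F (at p)) vs))"


section \<open>Algebraic geometry over the rationals\<close>

text \<open>
  \<open>'x qpoly\<close> is the polynomial ring over the rationals in variables indexed by \<open>'x\<close>. Varieties over
  the rationals are represented by their sets of complex points.
\<close>

type_synonym 'x qpoly = "('x \<Rightarrow>\<^sub>0 nat) \<Rightarrow>\<^sub>0 rat"

definition qpoly_eval :: "('x \<Rightarrow> complex) \<Rightarrow> 'x qpoly \<Rightarrow> complex" where
  "qpoly_eval x p = (\<Sum>m\<in>Poly_Mapping.keys p. of_rat (Poly_Mapping.lookup p m) *
      (\<Prod>i\<in>Poly_Mapping.keys m. x i ^ Poly_Mapping.lookup m i))"

definition zariski_open_over_Q :: "(complex^'n) set \<Rightarrow> bool" where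
  "zariski_open_over_Q U \<longleftrightarrow> (\<exists>S :: 'n qpoly set. U = {z. \<exists>p\<in>S. qpoly_eval (($) z) p \<noteq> 0})"

definition regular_over_Q :: "(complex^'n) set \<Rightarrow> (complex^'n \<Rightarrow> complex) \<Rightarrow> bool" where
  "regular_over_Q U \<phi> \<longleftrightarrow> (\<forall>z\<in>U. \<exists>g h :: 'n qpoly. qpoly_eval (($) z) h \<noteq> 0 \<and>
      (\<forall>w\<in>U. qpoly_eval (($) w) h \<noteq> 0 \<longrightarrow> \<phi> w = qpoly_eval (($) w) g / qpoly_eval (($) w) h))"

text \<open>
  Regular differential \<open>k\<close>-forms defined over the rationals. The sum runs over all index lists of
  length \<open>k\<close>, not only the increasing ones; this gives the same module of forms.
\<close>

definition algebraic_form_over_Q :: "nat \<Rightarrow> (complex^'n) set \<Rightarrow> (complex^'n) dform \<Rightarrow> bool" where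
  "algebraic_form_over_Q k U \<omega> \<longleftrightarrow> (\<exists>c :: 'n list \<Rightarrow> complex^'n \<Rightarrow> complex.
      (\<forall>is. length is = k \<longrightarrow> regular_over_Q U (c is)) \<and>
      (\<forall>z\<in>U. \<forall>vs. length vs = k \<longrightarrow>
         \<omega> z vs = (\<Sum>is | length is = k. c is z * wedge_d (map (\<lambda>i w. w $ i) is) z vs)))"

definition rat_span :: "('z \<Rightarrow> complex) set \<Rightarrow> ('z \<Rightarrow> complex) set" where
  "rat_span S = {f. \<exists>(n::nat) (c :: nat \<Rightarrow> rat) g. (\<forall>i<n. g i \<in> S) \<and>
      f = (\<lambda>z. \<Sum>i<n. of_rat (c i) * g i z)}"


section \<open>The form in both coordinate systems\<close>

text \<open>
  Source: points \<open>(t, \<eta>, \<xi>)\<close>. Target: points \<open>(u, \<alpha>, \<alpha>1, \<alpha>2)\<close> with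
  \<open>u = (u $ 0, \<dots>, u $ 4)\<close>; \<open>u $ 0\<close> is a coordinate of its own, as the index type is \<open>5\<close>.
\<close>

type_synonym source = "real \<times> real \<times> (real^4)"

type_synonym target = "(complex^5) \<times> complex \<times> complex \<times> complex"

definition src_eta :: "source \<Rightarrow> complex" where
  "src_eta = (\<lambda>(t, \<eta>, \<xi>). of_real \<eta>)"

definition src_xi :: "nat \<Rightarrow> source \<Rightarrow> complex" where
  "src_xi j = (\<lambda>(t, \<eta>, \<xi>). of_real (\<xi> $ of_nat j))"

definition sigma_xi3 :: "source dform" where
  "sigma_xi3 = (\<lambda>p vs. \<Sum>j = 1..4. (- 1) ^ (j - 1) * src_xi j p *
      wedge_d (map src_xi (filter (\<lambda>i. i \<noteq> j) [1, 2, 3, 4])) p vs)"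

definition b_form :: "(real \<Rightarrow> real) \<Rightarrow> real \<Rightarrow> real \<Rightarrow> source dform" where
  "b_form a \<phi>1 \<phi>2 = (\<lambda>(t, \<eta>, \<xi>) vs. b_minus4 a (vector [t, \<eta>, \<phi>1, \<phi>2]) \<xi> *
      wedge1 (differential src_eta) sigma_xi3 (t, \<eta>, \<xi>) vs)"

definition change_vars :: "(real \<Rightarrow> real) \<Rightarrow> source \<Rightarrow> target" where
  "change_vars a = (\<lambda>(t, \<eta>, \<xi>).
     (\<chi> i. of_real (if i = 0 then (sin \<eta>)\<^sup>2
                   else if i = 1 then \<xi> $ 1
                   else if i = 2 then \<xi> $ 2
                   else if i = 3 then csc \<eta> * \<xi> $ 3
                   else sec \<eta> * \<xi> $ 4),
      of_real (a t), of_real (deriv a t), of_real (deriv (deriv a) t)))"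

definition tgt_u :: "5 \<Rightarrow> target \<Rightarrow> complex" where
  "tgt_u j = (\<lambda>(u, \<alpha>, \<alpha>1, \<alpha>2). u $ j)"

definition sigma_tilde3 :: "target dform" where
  "sigma_tilde3 = (\<lambda>p vs. 1 / 2 *
     (tgt_u 1 p * wedge_d [tgt_u 0, tgt_u 2, tgt_u 3, tgt_u 4] p vs
    - tgt_u 2 p * wedge_d [tgt_u 0, tgt_u 1, tgt_u 3, tgt_u 4] p vs
    + tgt_u 3 p * wedge_d [tgt_u 0, tgt_u 1, tgt_u 2, tgt_u 4] p vs
    - tgt_u 4 p * wedge_d [tgt_u 0, tgt_u 1, tgt_u 2, tgt_u 3] p vs))"

definition Omega :: "(target \<Rightarrow> complex) \<Rightarrow> target dform" where
  "Omega f = (\<lambda>p vs. f p * sigma_tilde3 p vs)"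

text \<open>The variables \<open>u\<^sub>j\<close> are indexed by \<open>Inl j\<close>; \<open>\<alpha>, \<alpha>1, \<alpha>2\<close> are indexed by \<open>Inr 0, Inr 1, Inr 2\<close>.\<close>

definition assignment :: "target \<Rightarrow> 5 + 3 \<Rightarrow> complex" where
  "assignment = (\<lambda>(u, \<alpha>, \<alpha>1, \<alpha>2) v. case v of
       Inl j \<Rightarrow> u $ j
     | Inr k \<Rightarrow> if k = 0 then \<alpha> else if k = 1 then \<alpha>1 else \<alpha>2)"

definition quadric :: "complex \<Rightarrow> complex^5 \<Rightarrow> complex" where
  "quadric \<alpha> u = (u $ 1)\<^sup>2 + inverse (\<alpha>\<^sup>2) * ((u $ 2)\<^sup>2 + (u $ 3)\<^sup>2 + (u $ 4)\<^sup>2)"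

text \<open>
  Rational functions are represented by their values on complex points. Where a denominator
  vanishes the value is the conventional 0; only the complement of these loci matters below.
\<close>

definition basic_fraction :: "(5 + 3) qpoly \<Rightarrow> nat \<Rightarrow> nat \<Rightarrow> nat \<Rightarrow> nat \<Rightarrow> target \<Rightarrow> complex" where
  "basic_fraction P r k m l = (\<lambda>(u, \<alpha>, \<alpha>1, \<alpha>2). qpoly_eval (assignment (u, \<alpha>, \<alpha>1, \<alpha>2)) P /
      (\<alpha> ^ (2 * r) * (u $ 0) ^ k * (1 - u $ 0) ^ m * (quadric \<alpha> u) ^ l))"

definition basic_fractions :: "(target \<Rightarrow> complex) set" where
  "basic_fractions = {basic_fraction P r k m l | P r k m l. True}"

definition slice :: "rat \<Rightarrow> rat \<Rightarrow> rat \<Rightarrow> complex^5 \<Rightarrow> target" where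
  "slice \<alpha> \<alpha>1 \<alpha>2 = (\<lambda>u. (u, of_rat \<alpha>, of_rat \<alpha>1, of_rat \<alpha>2))"

definition H0 :: "(complex^5) set" where "H0 = {u. u $ 0 = 0}"

definition H1 :: "(complex^5) set" where "H1 = {u. u $ 0 = 1}"

definition CZ :: "rat \<Rightarrow> (complex^5) set" where "CZ \<alpha> = {u. quadric (of_rat \<alpha>) u = 0}"

end

theory Submission
  imports Defs
begin

text \<open>
  The principal symbol is a Clifford multiplication \<open>\<Sum>\<^sub>\<mu> c\<^sub>\<mu> \<gamma>\<^sub>\<mu>\<close> with real coefficients, so \<open>p\<^sub>2\<close> is the scalar
  \<open>|\<xi>|\<^sup>2\<close>, and \<open>p\<^sub>1\<close> is \<open>- i\<close> times a real scalar plus a real combination of traceless bivectors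
  \<open>\<gamma>\<^sub>\<mu> \<gamma>\<^sub>\<nu>\<close>. The recursion for \<open>\<sigma>\<^bsub>-4\<^esub>\<close> never differentiates \<open>\<sigma>\<^bsub>-2\<^esub>\<close>, \<open>\<sigma>\<^bsub>-3\<^esub>\<close> in \<open>x\<close>, so every trace in it is a
  polynomial in \<open>1 / |\<xi>|\<^sup>2\<close>, \<open>1 / a\<close>, \<open>a' / a\<close>, \<open>a'' / a\<close>, \<open>cot \<eta>\<close>, \<open>tan \<eta>\<close> and the \<open>\<xi>\<^sub>j\<close>. In the part that
  is even in each \<open>\<xi>\<^sub>j\<close>, the functions \<open>cot \<eta>\<close> and \<open>tan \<eta>\<close> occur only through their squares and their
  product 1, which makes it rational in \<open>u\<^sub>0 = sin\<^sup>2 \<eta>\<close>. The Jacobian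
  \<open>2 sin \<eta> cos \<eta> csc \<eta> sec \<eta> = 2\<close> cancels the factor \<open>1 / 2\<close> of \<open>sigma_tilde3\<close>.
\<close>

section \<open>Polynomial functions and fractions\<close>

text \<open>Matrix-valued derivatives are the obstacle: \<open>p1\<close> and the term of order -3
  have bivector coefficients containing \<open>csc\<close> and \<open>sec\<close>, with bulky
  derivatives. These are never computed. \<open>p2\<close>, the term of order -2 and all their
  derivatives are scalar, so a differentiated matrix always meets a scalar and only its trace
  counts; the trace commutes with the derivative, and of the matrix itself nothing but
  differentiability is used. The one product of two matrices that remains is
  \<open>p1 ** p1\<close>, whose trace has a closed form. One \<open>f\<close> must serve every
  scale factor. Hence the trace is brought to a fixed polynomial, \<open>trace_density\<close>, with
  the coefficient functions as arguments, and \<open>f\<close> is built from its sign average. The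
  parity in the angle has a geometric reason: the trace is invariant when \<open>cot \<eta>\<close>,
  \<open>tan \<eta>\<close> and \<open>\<xi> $ 2\<close> change sign together (reflection of
  \<eta>), so being even in \<open>\<xi> $ 2\<close> means being jointly even in the two
  functions.\<close>

definition monom_eval :: "('x \<Rightarrow> complex) \<Rightarrow> ('x \<Rightarrow>\<^sub>0 nat) \<Rightarrow> complex" where
  "monom_eval x m = (\<Prod>i\<in>Poly_Mapping.keys m. x i ^ Poly_Mapping.lookup m i)"

lemma monom_eval_superset:
  assumes "finite A" "Poly_Mapping.keys m \<subseteq> A"
  shows "monom_eval x m = (\<Prod>i\<in>A. x i ^ Poly_Mapping.lookup m i)"
  unfolding monom_eval_def using assms
  by (intro prod.mono_neutral_left) (auto simp: in_keys_iff)

lemma monom_eval_add: "monom_eval x (m + n) = monom_eval x m * monom_eval x n"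
proof -
  define A where "A = Poly_Mapping.keys m \<union> Poly_Mapping.keys n"
  have A: "finite A" "Poly_Mapping.keys m \<subseteq> A" "Poly_Mapping.keys n \<subseteq> A"
    "Poly_Mapping.keys (m + n) \<subseteq> A"
    using keys_add[of m n] by (auto simp: A_def)
  show ?thesis
    by (simp add: monom_eval_superset[OF A(1)] A lookup_add power_add prod.distrib)
qed

text \<open>Cancellation can make the keys of \<open>p + q\<close> smaller than the union of both
  key sets, so sums are compared over a common finite superset, where the extra coefficients are
  0.\<close>

lemma qpoly_eval_superset:
  assumes "finite A" "Poly_Mapping.keys p \<subseteq> A"
  shows "qpoly_eval x p = (\<Sum>m\<in>A. of_rat (Poly_Mapping.lookup p m) * monom_eval x m)"
  unfolding qpoly_eval_def monom_eval_def[symmetric] using assms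
  by (intro sum.mono_neutral_left) (auto simp: in_keys_iff)

lemma qpoly_eval_add: "qpoly_eval x (p + q) = qpoly_eval x p + qpoly_eval x q"
proof -
  define A where "A = Poly_Mapping.keys p \<union> Poly_Mapping.keys q"
  have A: "finite A" "Poly_Mapping.keys p \<subseteq> A" "Poly_Mapping.keys q \<subseteq> A"
    "Poly_Mapping.keys (p + q) \<subseteq> A"
    using keys_add[of p q] by (auto simp: A_def)
  show ?thesis
    by (simp add: qpoly_eval_superset[OF A(1)] A lookup_add of_rat_add sum.distrib ring_distribs)
qed

lemma qpoly_eval_zero: "qpoly_eval x 0 = 0"
  by (simp add: qpoly_eval_def)

lemma qpoly_eval_sum: "qpoly_eval x (\<Sum>i\<in>A. p i) = (\<Sum>i\<in>A. qpoly_eval x (p i))"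
  by (induction A rule: infinite_finite_induct) (auto simp: qpoly_eval_add qpoly_eval_zero)

lemma qpoly_eval_single: "qpoly_eval x (Poly_Mapping.single m c) = of_rat c * monom_eval x m"
  by (simp add: qpoly_eval_superset[of "{m}"])

lemma poly_mapping_sum_singles:
  "p = (\<Sum>m\<in>Poly_Mapping.keys p. Poly_Mapping.single m (Poly_Mapping.lookup p m))"
  by (rule poly_mapping_eqI)
     (auto simp: lookup_sum lookup_single when_def in_keys_iff)

lemma qpoly_eval_mult: "qpoly_eval x (p * q) = qpoly_eval x p * qpoly_eval x q"
proof -
  have "p * q = (\<Sum>m\<in>Poly_Mapping.keys p. \<Sum>n\<in>Poly_Mapping.keys q.
      Poly_Mapping.single (m + n) (Poly_Mapping.lookup p m * Poly_Mapping.lookup q n))"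
    by (subst poly_mapping_sum_singles[of p], subst poly_mapping_sum_singles[of q])
       (simp add: sum_product mult_single)
  then have "qpoly_eval x (p * q) = (\<Sum>m\<in>Poly_Mapping.keys p. \<Sum>n\<in>Poly_Mapping.keys q.
      (of_rat (Poly_Mapping.lookup p m) * monom_eval x m) *
      (of_rat (Poly_Mapping.lookup q n) * monom_eval x n))"
    by (simp add: qpoly_eval_sum qpoly_eval_single monom_eval_add of_rat_mult mult_ac)
  then show ?thesis
    by (simp add: qpoly_eval_def monom_eval_def sum_product)
qed

lemma qpoly_eval_const: "qpoly_eval x (Poly_Mapping.single 0 c) = of_rat c"
  by (simp add: qpoly_eval_single monom_eval_def)

lemma qpoly_eval_var: "qpoly_eval x (Poly_Mapping.single (Poly_Mapping.single i 1) 1) = x i"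
  by (simp add: qpoly_eval_single monom_eval_def)

lemma qpoly_eval_one: "qpoly_eval x 1 = 1"
  using qpoly_eval_const[of x 1] by simp

section \<open>Rational spans and the algebra of fractions\<close>

lemma rat_spanI:
  assumes "g \<in> S"
  shows "g \<in> rat_span S"
  unfolding rat_span_def
  by (rule CollectI, rule exI[of _ 1], rule exI[of _ "\<lambda>_. 1"], rule exI[of _ "\<lambda>_. g"])
     (use assms in simp)

text \<open>Hides the indexing of a linear combination: a property is checked for 0 and for adding
  one scaled generator.\<close>

lemma rat_span_induct [consumes 1, case_names zero add]:
  fixes f :: "'z \<Rightarrow> complex"
  assumes "f \<in> rat_span S"
    and "P (\<lambda>_. 0)"
    and "\<And>f c g. P f \<Longrightarrow> g \<in> S \<Longrightarrow> P (\<lambda>z. f z + of_rat c * g z)"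
  shows "P f"
proof -
  obtain n c and g :: "nat \<Rightarrow> 'z \<Rightarrow> complex" where f: "\<forall>i<n. g i \<in> S" "f = (\<lambda>z. \<Sum>i<n. of_rat (c i) * g i z)"
    using assms(1) unfolding rat_span_def by blast
  have "P (\<lambda>z. \<Sum>i<k. of_rat (c i) * g i z)" if "k \<le> n" for k
    using that
  proof (induction k)
    case 0
    then show ?case using assms(2) by simp
  next
    case (Suc k)
    then show ?case using assms(3)[of _ "g k" "c k"] f(1) by simp
  qed
  then show ?thesis using f by simp
qed

lemma rat_span_zero: "(\<lambda>_. 0) \<in> rat_span S"
  unfolding rat_span_def by (rule CollectI, rule exI[of _ 0]) simp

lemma rat_span_add_scaled:
  fixes f :: "'z \<Rightarrow> complex"
  assumes "f \<in> rat_span S" "g \<in> S"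
  shows "(\<lambda>z. f z + of_rat d * g z) \<in> rat_span S"
proof -
  obtain n c and h :: "nat \<Rightarrow> 'z \<Rightarrow> complex" where f: "\<forall>i<n. h i \<in> S" "f = (\<lambda>z. \<Sum>i<n. of_rat (c i) * h i z)"
    using assms(1) unfolding rat_span_def by blast
  show ?thesis unfolding rat_span_def
    by (rule CollectI, rule exI[of _ "Suc n"], rule exI[of _ "c(n := d)"], rule exI[of _ "h(n := g)"])
       (use f assms(2) in auto)
qed

lemma rat_span_add:
  assumes "f \<in> rat_span S" "g \<in> rat_span S"
  shows "(\<lambda>z. f z + g z) \<in> rat_span S"
  using assms(2)
proof (induction g rule: rat_span_induct)
  case zero
  then show ?case using assms(1) by simp
next
  case (add g c h)
  then show ?case using rat_span_add_scaled[of "\<lambda>z. f z + g z" S h c] by (simp add: add.assoc)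
qed

lemma rat_span_mult:
  assumes "f \<in> rat_span S" "g \<in> rat_span S"
    and "\<And>f g. f \<in> S \<Longrightarrow> g \<in> S \<Longrightarrow> (\<lambda>z. f z * g z) \<in> S"
  shows "(\<lambda>z. f z * g z) \<in> rat_span S"
  using assms(2)
proof (induction g rule: rat_span_induct)
  case zero
  then show ?case by (simp add: rat_span_zero)
next
  case (add g c h)
  \<comment> \<open>Inner induction over \<open>f\<close> with the single generator
    \<open>h\<close>; the scalar \<open>c\<close> stays inside so that the new term is one generator
    \<open>k * h\<close> with rational coefficient \<open>c * d\<close>.\<close>
  have "(\<lambda>z. of_rat c * (f z * h z)) \<in> rat_span S"
    using assms(1)
  proof (induction f rule: rat_span_induct)
    case zero
    then show ?case by (simp add: rat_span_zero)
  next
    case (add f d k)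
    then have "(\<lambda>z. of_rat c * (f z * h z) + of_rat (c * d) * (k z * h z)) \<in> rat_span S"
      using \<open>h \<in> S\<close> assms(3) by (intro rat_span_add_scaled)
    then show ?case by (simp add: algebra_simps of_rat_mult)
  qed
  then have "(\<lambda>z. f z * g z + of_rat c * (f z * h z)) \<in> rat_span S"
    using add by (intro rat_span_add)
  then show ?case by (simp add: algebra_simps)
qed

text \<open>This holds at every point: the convention that division by 0 gives 0 is multiplicative.\<close>

lemma basic_fractions_mult:
  assumes "f \<in> basic_fractions" "g \<in> basic_fractions"
  shows "(\<lambda>z. f z * g z) \<in> basic_fractions"
proof -
  obtain P r k m l where f: "f = basic_fraction P r k m l"
    using assms(1) unfolding basic_fractions_def by blast
  obtain P' r' k' m' l' where g: "g = basic_fraction P' r' k' m' l'"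
    using assms(2) unfolding basic_fractions_def by blast
  have "(\<lambda>z. f z * g z) = basic_fraction (P * P') (r + r') (k + k') (m + m') (l + l')"
    by (auto simp: f g basic_fraction_def qpoly_eval_mult power_add fun_eq_iff ring_distribs mult_ac)
  then show ?thesis unfolding basic_fractions_def by blast
qed

definition fractions :: "(target \<Rightarrow> complex) set" where
  "fractions = rat_span basic_fractions"

lemma fractions_add:
  "f \<in> fractions \<Longrightarrow> g \<in> fractions \<Longrightarrow> (\<lambda>z. f z + g z) \<in> fractions"
  unfolding fractions_def by (rule rat_span_add)

lemma fractions_mult:
  "f \<in> fractions \<Longrightarrow> g \<in> fractions \<Longrightarrow> (\<lambda>z. f z * g z) \<in> fractions"
  unfolding fractions_def by (intro rat_span_mult basic_fractions_mult)

lemma fractions_basic: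
  assumes "f = basic_fraction P r k m l"
  shows "f \<in> fractions"
  unfolding fractions_def assms by (intro rat_spanI) (unfold basic_fractions_def, blast)

lemma fractions_of_rat: "(\<lambda>_. of_rat c) \<in> fractions"
  by (rule fractions_basic[where P = "Poly_Mapping.single 0 c" and r = 0 and k = 0 and m = 0 and l = 0])
     (auto simp: basic_fraction_def qpoly_eval_const fun_eq_iff)

lemma fractions_numeral: "(\<lambda>_. numeral n) \<in> fractions"
  using fractions_of_rat[of "numeral n"] by simp

lemma fractions_one: "(\<lambda>_. 1) \<in> fractions"
  using fractions_of_rat[of 1] by simp

lemma fractions_uminus:
  assumes "f \<in> fractions"
  shows "(\<lambda>z. - f z) \<in> fractions"
  using fractions_mult[OF fractions_of_rat[of "- 1"] assms] by simp

lemma fractions_diff: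
  assumes "f \<in> fractions" "g \<in> fractions"
  shows "(\<lambda>z. f z - g z) \<in> fractions"
  using fractions_add[OF assms(1) fractions_uminus[OF assms(2)]] by simp

lemma fractions_power:
  assumes "f \<in> fractions"
  shows "(\<lambda>z. f z ^ n) \<in> fractions"
  by (induction n) (simp_all add: assms fractions_one fractions_mult)

lemma fractions_var: "(\<lambda>z. assignment z i) \<in> fractions"
  by (rule fractions_basic[where P = "Poly_Mapping.single (Poly_Mapping.single i 1) 1" and r = 0 and k = 0 and m = 0 and l = 0])
     (auto simp: basic_fraction_def qpoly_eval_var[simplified] fun_eq_iff)

text \<open>Denominators offer only even powers of \<alpha>, so 1/\<alpha> enters later as \<alpha>
  times this function. It and the next three inverses are written as pattern functions of the target
  point, the shape in which \<open>dirac_f\<close> uses them.\<close>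

lemma fractions_inverse_alpha2: "(\<lambda>(u, \<alpha>, \<alpha>1, \<alpha>2). inverse (\<alpha>\<^sup>2)) \<in> fractions"
  by (rule fractions_basic[where P = 1 and r = 1 and k = 0 and m = 0 and l = 0])
     (auto simp: basic_fraction_def qpoly_eval_one fun_eq_iff inverse_eq_divide)

lemma fractions_inverse_u0: "(\<lambda>(u, \<alpha>, \<alpha>1, \<alpha>2). inverse (u $ 0)) \<in> fractions"
  by (rule fractions_basic[where P = 1 and r = 0 and k = 1 and m = 0 and l = 0])
     (auto simp: basic_fraction_def qpoly_eval_one fun_eq_iff inverse_eq_divide)

lemma fractions_inverse_1_minus_u0: "(\<lambda>(u, \<alpha>, \<alpha>1, \<alpha>2). inverse (1 - u $ 0)) \<in> fractions"
  by (rule fractions_basic[where P = 1 and r = 0 and k = 0 and m = 1 and l = 0])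
     (auto simp: basic_fraction_def qpoly_eval_one fun_eq_iff inverse_eq_divide)

lemma fractions_inverse_quadric: "(\<lambda>(u, \<alpha>, \<alpha>1, \<alpha>2). inverse (quadric \<alpha> u)) \<in> fractions"
  by (rule fractions_basic[where P = 1 and r = 0 and k = 0 and m = 0 and l = 1])
     (auto simp: basic_fraction_def qpoly_eval_one fun_eq_iff inverse_eq_divide)

section \<open>Regular functions\<close>

lemma regular_over_QI:
  assumes "\<And>z. z \<in> U \<Longrightarrow> qpoly_eval (($) z) h \<noteq> 0"
    and "\<And>z. z \<in> U \<Longrightarrow> \<phi> z = qpoly_eval (($) z) g / qpoly_eval (($) z) h"
  shows "regular_over_Q U \<phi>"
  unfolding regular_over_Q_def using assms by blast

lemma regular_over_Q_of_rat: "regular_over_Q U (\<lambda>_. of_rat c)"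
  by (rule regular_over_QI[where h = 1 and g = "Poly_Mapping.single 0 c"])
     (auto simp: qpoly_eval_one qpoly_eval_const)

lemma regular_over_Q_component: "regular_over_Q U (\<lambda>z. z $ i)"
  by (rule regular_over_QI[where h = 1 and g = "Poly_Mapping.single (Poly_Mapping.single i 1) 1"])
     (auto simp: qpoly_eval_one qpoly_eval_var[simplified])

text \<open>Sums and products share a denominator: near \<open>z\<close> the product of the two
  given ones is nonzero, and only the numerator \<open>k\<close> depends on \<open>F\<close>. It
  must not depend on the point, hence the order of quantifiers in \<open>op\<close>.\<close>

lemma regular_over_Q_binop:
  fixes U :: "(complex^'n) set"
  assumes "regular_over_Q U \<phi>" "regular_over_Q U \<psi>"
    and op: "\<And>g h g' h' :: 'n qpoly. \<exists>k. \<forall>z. qpoly_eval (($) z) h \<noteq> 0 \<longrightarrow> qpoly_eval (($) z) h' \<noteq> 0 \<longrightarrow>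
      F (qpoly_eval (($) z) g / qpoly_eval (($) z) h) (qpoly_eval (($) z) g' / qpoly_eval (($) z) h') =
      qpoly_eval (($) z) k / (qpoly_eval (($) z) h * qpoly_eval (($) z) h')"
  shows "regular_over_Q U (\<lambda>z. F (\<phi> z) (\<psi> z))"
  unfolding regular_over_Q_def
proof
  fix z assume z: "z \<in> U"
  obtain g h where gh: "qpoly_eval (($) z) h \<noteq> 0"
    "\<And>w. w \<in> U \<Longrightarrow> qpoly_eval (($) w) h \<noteq> 0 \<Longrightarrow> \<phi> w = qpoly_eval (($) w) g / qpoly_eval (($) w) h"
    using assms(1) z unfolding regular_over_Q_def by blast
  obtain g' h' where gh': "qpoly_eval (($) z) h' \<noteq> 0"
    "\<And>w. w \<in> U \<Longrightarrow> qpoly_eval (($) w) h' \<noteq> 0 \<Longrightarrow> \<psi> w = qpoly_eval (($) w) g' / qpoly_eval (($) w) h'"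
    using assms(2) z unfolding regular_over_Q_def by blast
  obtain k where k: "\<And>z. qpoly_eval (($) z) h \<noteq> 0 \<Longrightarrow> qpoly_eval (($) z) h' \<noteq> 0 \<Longrightarrow>
      F (qpoly_eval (($) z) g / qpoly_eval (($) z) h) (qpoly_eval (($) z) g' / qpoly_eval (($) z) h') =
      qpoly_eval (($) z) k / (qpoly_eval (($) z) h * qpoly_eval (($) z) h')"
    using op[of h h' g g'] by blast
  show "\<exists>g h :: 'n qpoly. qpoly_eval (($) z) h \<noteq> 0 \<and>
      (\<forall>w\<in>U. qpoly_eval (($) w) h \<noteq> 0 \<longrightarrow> F (\<phi> w) (\<psi> w) = qpoly_eval (($) w) g / qpoly_eval (($) w) h)"
    by (rule exI[of _ k], rule exI[of _ "h * h'"]) (use gh gh' k in \<open>simp add: qpoly_eval_mult\<close>)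
qed

lemma regular_over_Q_add:
  fixes U :: "(complex^'n) set"
  assumes "regular_over_Q U \<phi>" "regular_over_Q U \<psi>"
  shows "regular_over_Q U (\<lambda>z. \<phi> z + \<psi> z)"
proof (rule regular_over_Q_binop[OF assms])
  fix g h g' h' :: "'n qpoly"
  show "\<exists>k. \<forall>z. qpoly_eval (($) z) h \<noteq> 0 \<longrightarrow> qpoly_eval (($) z) h' \<noteq> 0 \<longrightarrow>
      qpoly_eval (($) z) g / qpoly_eval (($) z) h + qpoly_eval (($) z) g' / qpoly_eval (($) z) h' =
      qpoly_eval (($) z) k / (qpoly_eval (($) z) h * qpoly_eval (($) z) h')"
    by (rule exI[of _ "g * h' + g' * h"]) (simp add: qpoly_eval_add qpoly_eval_mult divide_simps)
qed

lemma regular_over_Q_mult: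
  fixes U :: "(complex^'n) set"
  assumes "regular_over_Q U \<phi>" "regular_over_Q U \<psi>"
  shows "regular_over_Q U (\<lambda>z. \<phi> z * \<psi> z)"
proof (rule regular_over_Q_binop[OF assms])
  fix g h g' h' :: "'n qpoly"
  show "\<exists>k. \<forall>z. qpoly_eval (($) z) h \<noteq> 0 \<longrightarrow> qpoly_eval (($) z) h' \<noteq> 0 \<longrightarrow>
      qpoly_eval (($) z) g / qpoly_eval (($) z) h * (qpoly_eval (($) z) g' / qpoly_eval (($) z) h') =
      qpoly_eval (($) z) k / (qpoly_eval (($) z) h * qpoly_eval (($) z) h')"
    by (rule exI[of _ "g * g'"]) (simp add: qpoly_eval_mult)
qed

lemma regular_over_Q_sum:
  assumes "\<And>i. i \<in> A \<Longrightarrow> regular_over_Q U (\<phi> i)"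
  shows "regular_over_Q U (\<lambda>z. \<Sum>i\<in>A. \<phi> i z)"
  using assms
  by (induction A rule: infinite_finite_induct)
     (use regular_over_Q_of_rat[of U 0] in \<open>simp_all add: regular_over_Q_add\<close>)

lemma regular_over_Q_prod:
  assumes "\<And>i. i \<in> A \<Longrightarrow> regular_over_Q U (\<phi> i)"
  shows "regular_over_Q U (\<lambda>z. \<Prod>i\<in>A. \<phi> i z)"
  using assms
  by (induction A rule: infinite_finite_induct)
     (use regular_over_Q_of_rat[of U 1] in \<open>simp_all add: regular_over_Q_mult\<close>)

lemma regular_over_Q_power:
  assumes "regular_over_Q U \<phi>"
  shows "regular_over_Q U (\<lambda>z. \<phi> z ^ n)"
  using regular_over_Q_prod[of "{..<n}" U "\<lambda>_. \<phi>"] assms by simp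

lemma regular_over_Q_inverse:
  assumes "regular_over_Q U \<phi>" "\<And>z. z \<in> U \<Longrightarrow> \<phi> z \<noteq> 0"
  shows "regular_over_Q U (\<lambda>z. inverse (\<phi> z))"
  unfolding regular_over_Q_def
proof
  fix z assume z: "z \<in> U"
  obtain g h where gh: "qpoly_eval (($) z) h \<noteq> 0"
    "\<And>w. w \<in> U \<Longrightarrow> qpoly_eval (($) w) h \<noteq> 0 \<Longrightarrow> \<phi> w = qpoly_eval (($) w) g / qpoly_eval (($) w) h"
    using assms(1) z unfolding regular_over_Q_def by blast
  \<comment> \<open>The new fraction is \<open>h * h / (g * h)\<close> rather than
    \<open>h / g\<close>: non-vanishing of \<open>g * h\<close> at \<open>w\<close> also makes
    \<open>h\<close> nonzero there, where the given representation of \<open>\<phi>\<close> is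
    valid.\<close>
  have "qpoly_eval (($) z) (g * h) \<noteq> 0"
    using gh z assms(2)[OF z] by (auto simp: qpoly_eval_mult)
  moreover have "inverse (\<phi> w) = qpoly_eval (($) w) (h * h) / qpoly_eval (($) w) (g * h)"
    if "w \<in> U" "qpoly_eval (($) w) (g * h) \<noteq> 0" for w
    using that gh(2)[of w] by (auto simp: qpoly_eval_mult)
  ultimately show "\<exists>g h. qpoly_eval (($) z) h \<noteq> 0 \<and>
      (\<forall>w\<in>U. qpoly_eval (($) w) h \<noteq> 0 \<longrightarrow> inverse (\<phi> w) = qpoly_eval (($) w) g / qpoly_eval (($) w) h)"
    by blast
qed

lemma regular_over_Q_qpoly_eval:
  assumes "\<And>i. regular_over_Q U (\<lambda>z. x z i)"
  shows "regular_over_Q U (\<lambda>z. qpoly_eval (x z) p)"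
  unfolding qpoly_eval_def
  by (intro regular_over_Q_sum regular_over_Q_mult regular_over_Q_of_rat regular_over_Q_prod
      regular_over_Q_power assms)

text \<open>For rational parameters, \<alpha>, \<alpha>1 and \<alpha>2 become constants of the
  ground field, and the other factors of the denominator vanish only on the three removed
  loci.\<close>

lemma regular_over_Q_slice:
  assumes "f \<in> fractions" "\<alpha> \<noteq> 0"
  shows "regular_over_Q (- (H0 \<union> H1 \<union> CZ \<alpha>)) (\<lambda>u. f (slice \<alpha> \<alpha>1 \<alpha>2 u))"
  using assms(1) unfolding fractions_def
proof (induction f rule: rat_span_induct)
  case zero
  then show ?case using regular_over_Q_of_rat[of _ 0] by simp
next
  case (add f c g)
  let ?U = "- (H0 \<union> H1 \<union> CZ \<alpha>)"
  obtain P r k m l where g: "g = basic_fraction P r k m l"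
    using add unfolding basic_fractions_def by blast
  have "regular_over_Q ?U (\<lambda>u. (u $ 1)\<^sup>2 + of_rat (inverse (\<alpha>\<^sup>2)) * ((u $ 2)\<^sup>2 + (u $ 3)\<^sup>2 + (u $ 4)\<^sup>2))"
    by (intro regular_over_Q_add regular_over_Q_mult regular_over_Q_power regular_over_Q_of_rat
        regular_over_Q_component)
  then have quadric: "regular_over_Q ?U (quadric (of_rat \<alpha>))"
    by (simp add: quadric_def [abs_def] of_rat_inverse of_rat_power)
  have "regular_over_Q ?U (\<lambda>u. of_rat 1 + of_rat (- 1) * u $ 0)"
    by (intro regular_over_Q_add regular_over_Q_mult regular_over_Q_of_rat regular_over_Q_component)
  then have one_minus: "regular_over_Q ?U (\<lambda>u. 1 - u $ 0)"
    by simp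
  have g': "g (slice \<alpha> \<alpha>1 \<alpha>2 u) = qpoly_eval (assignment (slice \<alpha> \<alpha>1 \<alpha>2 u)) P *
      inverse (of_rat \<alpha> ^ (2 * r) * (u $ 0) ^ k * (1 - u $ 0) ^ m * (quadric (of_rat \<alpha>) u) ^ l)" for u
    by (simp add: g basic_fraction_def slice_def field_simps)
  have vars: "regular_over_Q ?U (\<lambda>u. assignment (slice \<alpha> \<alpha>1 \<alpha>2 u) i)" for i
    by (cases i) (auto simp: assignment_def slice_def
        intro: regular_over_Q_of_rat regular_over_Q_component)
  have "regular_over_Q ?U (\<lambda>u. g (slice \<alpha> \<alpha>1 \<alpha>2 u))"
    unfolding g'
    by (intro regular_over_Q_mult regular_over_Q_qpoly_eval vars regular_over_Q_inverse
        regular_over_Q_power regular_over_Q_of_rat regular_over_Q_component quadric one_minus)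
       (use \<open>\<alpha> \<noteq> 0\<close> in \<open>auto simp: H0_def H1_def CZ_def\<close>)
  then show ?case
    using add by (intro regular_over_Q_add regular_over_Q_mult regular_over_Q_of_rat)
qed

text \<open>A single polynomial suffices: the product of the equations of the three loci.\<close>

lemma zariski_open_complement: "zariski_open_over_Q (- (H0 \<union> H1 \<union> CZ \<alpha>))"
proof -
  define v :: "5 \<Rightarrow> 5 qpoly" where "v i = Poly_Mapping.single (Poly_Mapping.single i 1) 1" for i
  define p where "p = v 0 * (1 + Poly_Mapping.single 0 (- 1) * v 0) *
    (v 1 * v 1 + Poly_Mapping.single 0 (inverse (\<alpha>\<^sup>2)) * (v 2 * v 2 + v 3 * v 3 + v 4 * v 4))"
  have "qpoly_eval (($) u) p = u $ 0 * (1 - u $ 0) * quadric (of_rat \<alpha>) u" for u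
    by (simp add: p_def v_def qpoly_eval_mult qpoly_eval_add qpoly_eval_var[simplified] qpoly_eval_const
        qpoly_eval_one quadric_def of_rat_inverse of_rat_power power2_eq_square of_rat_mult)
  then have "- (H0 \<union> H1 \<union> CZ \<alpha>) = {z. \<exists>p\<in>{p}. qpoly_eval (($) z) p \<noteq> 0}"
    by (auto simp: H0_def H1_def CZ_def)
  then show ?thesis unfolding zariski_open_over_Q_def by blast
qed

section \<open>The coordinate change on forms\<close>

lemma has_derivative_vec_lambda:
  fixes f :: "'a::real_normed_vector \<Rightarrow> 'n::finite \<Rightarrow> 'b::euclidean_space"
  assumes "\<And>i. ((\<lambda>x. f x i) has_derivative (\<lambda>h. f' h i)) (at p)"
  shows "((\<lambda>x. \<chi> i. f x i) has_derivative (\<lambda>h. \<chi> i. f' h i)) (at p)"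
  by (subst has_derivative_componentwise_within)
     (auto simp: Basis_vec_def inner_axis intro!: has_derivative_inner_left assms)

lemma frechet_derivative_tgt_u: "frechet_derivative (tgt_u j) (at p) = tgt_u j"
proof -
  have "bounded_linear (tgt_u j)"
    unfolding tgt_u_def case_prod_beta
    by (intro bounded_linear_compose[OF bounded_linear_vec_nth] bounded_linear_fst)
  then show ?thesis
    by (metis bounded_linear_imp_has_derivative frechet_derivative_at)
qed

lemma frechet_derivative_src_xi: "frechet_derivative (src_xi j) (at p) = src_xi j"
proof -
  have "bounded_linear (src_xi j)"
    unfolding src_xi_def case_prod_beta
    by (intro bounded_linear_compose[OF bounded_linear_of_real]
        bounded_linear_compose[OF bounded_linear_vec_nth]
        bounded_linear_compose[OF bounded_linear_snd] bounded_linear_snd)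
  then show ?thesis
    by (metis bounded_linear_imp_has_derivative frechet_derivative_at)
qed

lemma frechet_derivative_src_eta: "frechet_derivative src_eta (at p) = src_eta"
proof -
  have "bounded_linear src_eta"
    unfolding src_eta_def case_prod_beta
    by (intro bounded_linear_compose[OF bounded_linear_of_real]
        bounded_linear_compose[OF bounded_linear_fst] bounded_linear_snd)
  then show ?thesis
    by (metis bounded_linear_imp_has_derivative frechet_derivative_at)
qed

lemma frechet_derivative_slice:
  "frechet_derivative (slice \<alpha> \<alpha>1 \<alpha>2) (at p) = (\<lambda>v. (v, 0, 0, 0))"
proof -
  have "(slice \<alpha> \<alpha>1 \<alpha>2 has_derivative (\<lambda>v. (v, 0, 0, 0))) (at p)"
    unfolding slice_def by (intro has_derivative_Pair has_derivative_ident has_derivative_const)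
  then show ?thesis by (metis frechet_derivative_at)
qed

lemma frechet_derivative_component:
  "frechet_derivative (\<lambda>w. w $ i :: complex) (at (p :: complex^'n)) = (\<lambda>w. w $ i)"
  by (metis bounded_linear_imp_has_derivative bounded_linear_vec_nth frechet_derivative_at)

lemma length_4_conv: "length vs = 4 \<longleftrightarrow> (\<exists>v0 v1 v2 v3. vs = [v0, v1, v2, v3])"
  by (auto simp: numeral_eq_Suc length_Suc_conv)

section \<open>Wedge products as determinants\<close>

lemma wedge1_expand:
  "wedge1 \<theta> \<omega> p [x] = \<theta> p [x] * \<omega> p []"
  "wedge1 \<theta> \<omega> p [x, y] = \<theta> p [x] * \<omega> p [y] - \<theta> p [y] * \<omega> p [x]"
  "wedge1 \<theta> \<omega> p [x, y, z] = \<theta> p [x] * \<omega> p [y, z] - \<theta> p [y] * \<omega> p [x, z] + \<theta> p [z] * \<omega> p [x, y]"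
  "wedge1 \<theta> \<omega> p [x, y, z, w] = \<theta> p [x] * \<omega> p [y, z, w] - \<theta> p [y] * \<omega> p [x, z, w]
    + \<theta> p [z] * \<omega> p [x, y, w] - \<theta> p [w] * \<omega> p [x, y, z]"
  by (simp_all add: wedge1_def lessThan_Suc)

text \<open>\<open>alt3\<close> and \<open>alt4\<close> are the determinants of the values of the
  1-forms on the vectors, expanded along the first form.\<close>

definition alt3 :: "('v \<Rightarrow> complex) \<Rightarrow> ('v \<Rightarrow> complex) \<Rightarrow> ('v \<Rightarrow> complex) \<Rightarrow> 'v \<Rightarrow> 'v \<Rightarrow> 'v \<Rightarrow> complex" where
  "alt3 B C D x y z =
     B x * (C y * D z - C z * D y) - B y * (C x * D z - C z * D x) + B z * (C x * D y - C y * D x)"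

definition alt4 :: "('v \<Rightarrow> complex) \<Rightarrow> ('v \<Rightarrow> complex) \<Rightarrow> ('v \<Rightarrow> complex) \<Rightarrow> ('v \<Rightarrow> complex) \<Rightarrow> 'v \<Rightarrow> 'v \<Rightarrow> 'v \<Rightarrow> 'v \<Rightarrow> complex" where
  "alt4 A B C D x y z w =
     A x * alt3 B C D y z w - A y * alt3 B C D x z w + A z * alt3 B C D x y w - A w * alt3 B C D x y z"

lemma wedge_d_3:
  "wedge_d [f1, f2, f3] p [x, y, z] =
    alt3 (frechet_derivative f1 (at p)) (frechet_derivative f2 (at p)) (frechet_derivative f3 (at p)) x y z"
  by (simp add: wedge_d_def wedge1_expand differential_def unit_form_def alt3_def)

lemma wedge_d_4:
  "wedge_d [f0, f1, f2, f3] p [x, y, z, w] =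
    alt4 (frechet_derivative f0 (at p)) (frechet_derivative f1 (at p)) (frechet_derivative f2 (at p))
      (frechet_derivative f3 (at p)) x y z w"
  by (simp add: wedge_d_def wedge1_expand differential_def unit_form_def alt4_def alt3_def)

text \<open>The extra multiples of \<open>A\<close> in the later forms disappear by alternation,
  because \<open>A\<close> itself is the first form. With \<open>A\<close> the form d\<eta>, this
  removes the d\<eta>-terms of du3 and du4, and only the diagonal coefficients survive.\<close>

lemma alt4_linear:
  assumes "\<And>v. A' (g v) = k * A v" "\<And>v. B' (g v) = b * B v + b' * A v"
    "\<And>v. C' (g v) = c * C v + c' * A v" "\<And>v. D' (g v) = d * D v + d' * A v"
  shows "alt4 A' B' C' D' (g x) (g y) (g z) (g w) = k * b * c * d * alt4 A B C D x y z w"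
  unfolding alt4_def alt3_def assms by (simp add: algebra_simps)

text \<open>All eight components are differentiated, including those depending on \<open>t\<close>:
  \<open>pullback\<close> uses the Frechet derivative of the whole map, so the third derivative of
  \<open>a\<close> has to exist.\<close>

lemma has_derivative_change_vars:
  assumes "a differentiable (at t)" "deriv a differentiable (at t)"
    "deriv (deriv a) differentiable (at t)" "sin \<eta> \<noteq> 0" "cos \<eta> \<noteq> 0"
  shows "(change_vars a has_derivative (\<lambda>(dt, d\<eta>, d\<xi>).
     (\<chi> i. of_real (if i = 0 then 2 * sin \<eta> * cos \<eta> * d\<eta>
                   else if i = 1 then d\<xi> $ 1
                   else if i = 2 then d\<xi> $ 2
                   else if i = 3 then csc \<eta> * d\<xi> $ 3 - cos \<eta> * (csc \<eta>)\<^sup>2 * \<xi> $ 3 * d\<eta>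
                   else sec \<eta> * d\<xi> $ 4 + sin \<eta> * (sec \<eta>)\<^sup>2 * \<xi> $ 4 * d\<eta>),
      of_real (deriv a t * dt), of_real (deriv (deriv a) t * dt),
      of_real (deriv (deriv (deriv a)) t * dt)))) (at (t, \<eta>, \<xi>))"
proof -
  have comp: "((\<lambda>p :: source. g (fst p)) has_derivative (\<lambda>h. deriv g t * fst h)) (at (t, \<eta>, \<xi>))"
    if "g differentiable (at t)" for g :: "real \<Rightarrow> real"
    using that DERIV_compose_FDERIV[of g "deriv g t" fst "(t, \<eta>, \<xi>)" fst UNIV]
    by (simp add: DERIV_deriv_iff_real_differentiable has_derivative_fst mult.commute)
  have xi: "((\<lambda>p :: source. snd (snd p) $ j) has_derivative (\<lambda>h. snd (snd h) $ j)) (at p)" for j p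
    by (intro bounded_linear.has_derivative[OF bounded_linear_vec_nth] derivative_intros)
  show ?thesis
    unfolding change_vars_def case_prod_beta
  proof (intro has_derivative_Pair has_derivative_of_real comp assms has_derivative_vec_lambda)
    fix i :: 5
    show "((\<lambda>p :: source. if i = 0 then (sin (fst (snd p)))\<^sup>2
        else if i = 1 then snd (snd p) $ 1
        else if i = 2 then snd (snd p) $ 2
        else if i = 3 then csc (fst (snd p)) * snd (snd p) $ 3
        else sec (fst (snd p)) * snd (snd p) $ 4) has_derivative
      (\<lambda>h. if i = 0 then 2 * sin \<eta> * cos \<eta> * fst (snd h)
        else if i = 1 then snd (snd h) $ 1
        else if i = 2 then snd (snd h) $ 2
        else if i = 3 then csc \<eta> * snd (snd h) $ 3 - cos \<eta> * (csc \<eta>)\<^sup>2 * \<xi> $ 3 * fst (snd h)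
        else sec \<eta> * snd (snd h) $ 4 + sin \<eta> * (sec \<eta>)\<^sup>2 * \<xi> $ 4 * fst (snd h))) (at (t, \<eta>, \<xi>))"
      using assms(4,5)
      by (cases "i = 0"; cases "i = 1"; cases "i = 2"; cases "i = 3")
         (auto intro!: derivative_eq_intros xi simp: csc_def sec_def field_simps power2_eq_square)
  qed
qed

text \<open>Each of the four terms acquires the same factor \<open>k * c * d\<close>: a term whose
  wedge lacks \<open>tgt_u 3\<close> (or \<open>tgt_u 4\<close>) has that coordinate as its
  coefficient, and the coordinate supplies the missing \<open>c\<close> (or
  \<open>d\<close>).\<close>

lemma pullback_sigma_tilde3:
  assumes "a differentiable (at t)" "deriv a differentiable (at t)"
    "deriv (deriv a) differentiable (at t)" "sin \<eta> \<noteq> 0" "cos \<eta> \<noteq> 0" "length vs = 4"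
  shows "pullback (change_vars a) sigma_tilde3 (t, \<eta>, \<xi>) vs =
    wedge1 (differential src_eta) sigma_xi3 (t, \<eta>, \<xi>) vs"
proof -
  obtain v0 v1 v2 v3 where vs: "vs = [v0, v1, v2, v3]"
    using assms(6) unfolding length_4_conv by blast
  define dF where "dF = frechet_derivative (change_vars a) (at (t, \<eta>, \<xi>))"
  have dF: "dF = (\<lambda>(dt, d\<eta>, d\<xi>).
     (\<chi> i. of_real (if i = 0 then 2 * sin \<eta> * cos \<eta> * d\<eta>
                   else if i = 1 then d\<xi> $ 1
                   else if i = 2 then d\<xi> $ 2
                   else if i = 3 then csc \<eta> * d\<xi> $ 3 - cos \<eta> * (csc \<eta>)\<^sup>2 * \<xi> $ 3 * d\<eta>
                   else sec \<eta> * d\<xi> $ 4 + sin \<eta> * (sec \<eta>)\<^sup>2 * \<xi> $ 4 * d\<eta>),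
      of_real (deriv a t * dt), of_real (deriv (deriv a) t * dt),
      of_real (deriv (deriv (deriv a)) t * dt)))"
    unfolding dF_def by (rule frechet_derivative_at[OF has_derivative_change_vars[OF assms(1-5)], symmetric])
  define k where "k = complex_of_real (2 * sin \<eta> * cos \<eta>)"
  define c where "c = complex_of_real (csc \<eta>)"
  define c' where "c' = - complex_of_real (cos \<eta> * (csc \<eta>)\<^sup>2 * \<xi> $ 3)"
  define d where "d = complex_of_real (sec \<eta>)"
  define d' where "d' = complex_of_real (sin \<eta> * (sec \<eta>)\<^sup>2 * \<xi> $ 4)"
  \<comment> \<open>The factors 1 and 0 give the equations the shape of the premises of
    \<open>alt4_linear\<close>.\<close>
  have u: "tgt_u 0 (dF v) = k * src_eta v" "tgt_u 1 (dF v) = 1 * src_xi (Suc 0) v + 0 * src_eta v"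
    "tgt_u 2 (dF v) = 1 * src_xi 2 v + 0 * src_eta v" "tgt_u 3 (dF v) = c * src_xi 3 v + c' * src_eta v"
    "tgt_u 4 (dF v) = d * src_xi 4 v + d' * src_eta v" for v
    by (auto simp: tgt_u_def dF src_eta_def src_xi_def k_def c_def c'_def d_def d'_def split: prod.splits)
  have kcd: "k * c * d = 2"
    using assms(4,5) by (simp add: k_def c_def d_def csc_def sec_def)
  have u_at: "tgt_u 1 (change_vars a (t, \<eta>, \<xi>)) = src_xi 1 (t, \<eta>, \<xi>)"
    "tgt_u 2 (change_vars a (t, \<eta>, \<xi>)) = src_xi 2 (t, \<eta>, \<xi>)"
    "tgt_u 3 (change_vars a (t, \<eta>, \<xi>)) = c * src_xi 3 (t, \<eta>, \<xi>)"
    "tgt_u 4 (change_vars a (t, \<eta>, \<xi>)) = d * src_xi 4 (t, \<eta>, \<xi>)"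
    by (auto simp: tgt_u_def change_vars_def src_xi_def c_def d_def)
  have alt:
    "alt4 (tgt_u 0) (tgt_u 2) (tgt_u 3) (tgt_u 4) (dF v0) (dF v1) (dF v2) (dF v3) =
       k * 1 * c * d * alt4 src_eta (src_xi 2) (src_xi 3) (src_xi 4) v0 v1 v2 v3"
    "alt4 (tgt_u 0) (tgt_u 1) (tgt_u 3) (tgt_u 4) (dF v0) (dF v1) (dF v2) (dF v3) =
       k * 1 * c * d * alt4 src_eta (src_xi (Suc 0)) (src_xi 3) (src_xi 4) v0 v1 v2 v3"
    "alt4 (tgt_u 0) (tgt_u 1) (tgt_u 2) (tgt_u 4) (dF v0) (dF v1) (dF v2) (dF v3) =
       k * 1 * 1 * d * alt4 src_eta (src_xi (Suc 0)) (src_xi 2) (src_xi 4) v0 v1 v2 v3"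
    "alt4 (tgt_u 0) (tgt_u 1) (tgt_u 2) (tgt_u 3) (dF v0) (dF v1) (dF v2) (dF v3) =
       k * 1 * 1 * c * alt4 src_eta (src_xi (Suc 0)) (src_xi 2) (src_xi 3) v0 v1 v2 v3"
    by (rule alt4_linear[where g = dF]; fact u)+
  have "pullback (change_vars a) sigma_tilde3 (t, \<eta>, \<xi>) vs = (k * c * d) / 2 *
      (src_xi 1 (t, \<eta>, \<xi>) * alt4 src_eta (src_xi 2) (src_xi 3) (src_xi 4) v0 v1 v2 v3
     - src_xi 2 (t, \<eta>, \<xi>) * alt4 src_eta (src_xi 1) (src_xi 3) (src_xi 4) v0 v1 v2 v3
     + src_xi 3 (t, \<eta>, \<xi>) * alt4 src_eta (src_xi 1) (src_xi 2) (src_xi 4) v0 v1 v2 v3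
     - src_xi 4 (t, \<eta>, \<xi>) * alt4 src_eta (src_xi 1) (src_xi 2) (src_xi 3) v0 v1 v2 v3)"
    unfolding pullback_def sigma_tilde3_def vs list.map dF_def[symmetric] wedge_d_4 frechet_derivative_tgt_u alt u_at
    by (simp add: algebra_simps)
  also have "\<dots> = wedge1 (differential src_eta) sigma_xi3 (t, \<eta>, \<xi>) vs"
    unfolding kcd vs wedge1_expand sigma_xi3_def differential_def
    by (simp add: eval_nat_numeral wedge_d_3 frechet_derivative_src_xi frechet_derivative_src_eta alt4_def algebra_simps)
  finally show ?thesis .
qed

lemma algebraic_form_slice:
  assumes "f \<in> fractions" "\<alpha> \<noteq> 0"
  shows "algebraic_form_over_Q 4 (- (H0 \<union> H1 \<union> CZ \<alpha>)) (pullback (slice \<alpha> \<alpha>1 \<alpha>2) (Omega f))"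
proof -
  let ?U = "- (H0 \<union> H1 \<union> CZ \<alpha>)" and ?s = "slice \<alpha> \<alpha>1 \<alpha>2"
  define cf :: "rat \<Rightarrow> 5 \<Rightarrow> complex^5 \<Rightarrow> complex"
    where "cf q j = (\<lambda>z. f (?s z) * (of_rat q * z $ j))" for q j
  have cf: "regular_over_Q ?U (cf q j)" for q j
    unfolding cf_def
    by (intro regular_over_Q_mult regular_over_Q_slice assms regular_over_Q_of_rat regular_over_Q_component)
  \<comment> \<open>The values are the coefficients of \<open>sigma_tilde3\<close> on its four
    increasing index lists; every other list gets 0, so the sum over all lists of length 4
    collapses.\<close>
  define c :: "5 list \<Rightarrow> complex^5 \<Rightarrow> complex" where "c is =
    (if is = [0, 2, 3, 4] then cf (1/2) 1 else if is = [0, 1, 3, 4] then cf (-1/2) 2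
     else if is = [0, 1, 2, 4] then cf (1/2) 3 else if is = [0, 1, 2, 3] then cf (-1/2) 4
     else (\<lambda>_. 0))" for "is"
  have c: "regular_over_Q ?U (c is)" for "is"
    using regular_over_Q_of_rat[of ?U 0] unfolding c_def by (simp only: cf of_rat_0 if_split) simp
  have lin: "frechet_derivative (\<lambda>w. w $ i) (at z) = (\<lambda>v. tgt_u i (v, 0, 0, 0))" for i and z :: "complex^5"
    by (simp add: frechet_derivative_component tgt_u_def)
  have "pullback ?s (Omega f) z vs =
      (\<Sum>is | length is = 4. c is z * wedge_d (map (\<lambda>i w. w $ i) is) z vs)" if "length vs = 4" for z vs
  proof -
    obtain v0 v1 v2 v3 where vs: "vs = [v0, v1, v2, v3]"
      using \<open>length vs = 4\<close> unfolding length_4_conv by blast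
    have "(\<Sum>is | length is = 4. c is z * wedge_d (map (\<lambda>i w. w $ i) is) z vs) =
      (\<Sum>is\<in>{[0, 2, 3, 4], [0, 1, 3, 4], [0, 1, 2, 4], [0, 1, 2, 3]}. c is z * wedge_d (map (\<lambda>i w. w $ i) is) z vs)"
      using finite_lists_length_eq[of "UNIV :: 5 set" 4]
      by (intro sum.mono_neutral_right) (auto simp: c_def)
    also have "\<dots> = pullback ?s (Omega f) z vs"
      unfolding pullback_def Omega_def sigma_tilde3_def vs list.map frechet_derivative_slice
      by (simp add: c_def cf_def wedge_d_4 frechet_derivative_tgt_u lin alt4_def alt3_def)
         (simp add: tgt_u_def slice_def of_rat_divide of_rat_minus algebra_simps)
    finally show ?thesis by simp
  qed
  then show ?thesis
    unfolding algebraic_form_over_Q_def using c by blast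
qed

section \<open>Matrices\<close>

lemma vector_4 [simp]:
  "(vector [x, y, z, w] :: 'a::zero^4) $ 1 = x" "(vector [x, y, z, w] :: 'a::zero^4) $ 2 = y"
  "(vector [x, y, z, w] :: 'a::zero^4) $ 3 = z" "(vector [x, y, z, w] :: 'a::zero^4) $ 4 = w"
  unfolding vector_def by simp_all

lemma sum_2_plus_2: "(\<Sum>i\<in>UNIV. f (i :: 2 + 2)) = f (Inl 1) + f (Inl 2) + (f (Inr 1) + f (Inr 2))"
  by (simp add: UNIV_Plus_UNIV[symmetric] sum.Plus sum_2 o_def del: UNIV_Plus_UNIV)

lemma forall_2_plus_2: "(\<forall>i :: 2 + 2. P i) \<longleftrightarrow> P (Inl 1) \<and> P (Inl 2) \<and> P (Inr 1) \<and> P (Inr 2)"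
  by (simp add: split_sum_all forall_2)

lemma scaleR_matrix_mult:
  fixes A :: "complex^'n::finite^'m::finite" and B :: "complex^'k::finite^'n"
  shows "(r *\<^sub>R A) ** B = r *\<^sub>R (A ** B)" "A ** (r *\<^sub>R B) = r *\<^sub>R (A ** B)"
  by (simp_all add: vec_eq_iff matrix_matrix_mult_def scaleR_sum_right)

text \<open>Real coefficients stay under \<open>scaleR\<close>, where the derivative rules for real
  functions apply; \<open>cscale\<close> carries the remaining complex constants.\<close>

lemma cscale_matrix_mult:
  "cscale c A ** B = cscale c (A ** B)" "A ** cscale c B = cscale c (A ** B)"
  by (simp_all add: vec_eq_iff matrix_matrix_mult_def cscale_def sum_distrib_left mult_ac)

lemma cscale_simps:
  "cscale c (A + B) = cscale c A + cscale c B"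
  "cscale c (A - B) = cscale c A - cscale c B"
  "cscale c (- A) = - cscale c A"
  "cscale c (r *\<^sub>R A) = r *\<^sub>R cscale c A"
  "cscale c (cscale d A) = cscale (c * d) A"
  "cscale c 0 = 0"
  "cscale 1 A = A"
  by (simp_all add: vec_eq_iff cscale_def algebra_simps)

lemma matrix_mult_minus:
  fixes A :: "complex^'n::finite^'m::finite" and B :: "complex^'k::finite^'n"
  shows "(- A) ** B = - (A ** B)" "A ** (- B) = - (A ** B)"
  by (simp_all add: vec_eq_iff matrix_matrix_mult_def sum_negf)

lemma matrix_add_rdistrib:
  fixes A B :: "complex^'n::finite^'m::finite" and C :: "complex^'k::finite^'n"
  shows "(A + B) ** C = A ** C + B ** C"
  by (simp add: vec_eq_iff matrix_matrix_mult_def sum.distrib ring_distribs)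

lemma matrix_diff_distrib:
  fixes A B :: "complex^'n::finite^'m::finite" and C D :: "complex^'k::finite^'n"
  shows "(A - B) ** C = A ** C - B ** C" "A ** (C - D) = A ** C - A ** D"
  by (simp_all add: vec_eq_iff matrix_matrix_mult_def sum_subtractf ring_distribs)

lemmas matrix_bilinear = matrix_add_ldistrib matrix_add_rdistrib scaleR_matrix_mult cscale_matrix_mult
  matrix_diff_distrib matrix_mult_minus

lemma trace_scaleR: "trace (r *\<^sub>R A) = of_real r * trace (A :: complex^'n::finite^'n)"
  by (simp add: trace_def sum_distrib_left scaleR_conv_of_real[where 'a = complex])

lemma trace_cscale: "trace (cscale c A) = c * trace A"
  by (simp add: trace_def cscale_def sum_distrib_left)

lemma trace_uminus: "trace (- A) = - trace (A :: complex^'n::finite^'n)"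
  by (simp add: trace_def sum_negf)

lemma bounded_linear_trace: "bounded_linear (trace :: complex^'n::finite^'n \<Rightarrow> complex)"
  unfolding trace_def
  by (intro bounded_linear_sum bounded_linear_compose[OF bounded_linear_vec_nth] bounded_linear_vec_nth)

text \<open>\<open>matrix_inv\<close> is a choice, so an inverse is exhibited first; then the
  equation satisfied by the chosen matrix determines it.\<close>

lemma matrix_inv_scaleR:
  assumes "r \<noteq> 0"
  shows "matrix_inv (r *\<^sub>R (mat 1 :: complex^'n::finite^'n)) = inverse r *\<^sub>R mat 1"
proof -
  let ?A = "r *\<^sub>R (mat 1 :: complex^'n^'n)"
  have "?A ** (inverse r *\<^sub>R mat 1) = mat 1 \<and> (inverse r *\<^sub>R mat 1) ** ?A = mat 1"
    using assms by (simp add: scaleR_matrix_mult)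
  then have "?A ** matrix_inv ?A = mat 1 \<and> matrix_inv ?A ** ?A = mat 1"
    unfolding matrix_inv_def by (rule someI)
  then have "r *\<^sub>R matrix_inv ?A = mat 1"
    by (simp add: scaleR_matrix_mult)
  then have "inverse r *\<^sub>R (r *\<^sub>R matrix_inv ?A) = inverse r *\<^sub>R mat 1"
    by simp
  then show ?thesis using assms by simp
qed

section \<open>Clifford generators and the symbols expressed in them\<close>

type_synonym spin = "complex^(2 + 2)^(2 + 2)"

text \<open>\<open>g1\<close>, ..., \<open>g4\<close> are the coefficient matrices of
  \<open>q1\<close> with respect to the orthonormal components \<xi>1, \<xi>2/a, csc(\<eta>)
  \<xi>3/a, sec(\<eta>) \<xi>4/a, read off from the entries of \<open>A1\<close> and
  \<open>B1\<close>. They generate a Euclidean Clifford algebra.\<close>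

definition g1 :: spin where
  "g1 = off_diag (vector [vector [- 1, 0], vector [0, - 1]]) (vector [vector [- 1, 0], vector [0, - 1]])"

definition g2 :: spin where
  "g2 = off_diag (vector [vector [0, \<i>], vector [\<i>, 0]]) (vector [vector [0, - \<i>], vector [- \<i>, 0]])"

definition g3 :: spin where
  "g3 = off_diag (vector [vector [0, 1], vector [- 1, 0]]) (vector [vector [0, - 1], vector [1, 0]])"

definition g4 :: spin where
  "g4 = off_diag (vector [vector [\<i>, 0], vector [0, - \<i>]]) (vector [vector [- \<i>, 0], vector [0, \<i>]])"

lemma off_diag_nth:
  "off_diag A B $ Inl k $ Inl l = 0" "off_diag A B $ Inl k $ Inr l = A $ k $ l"
  "off_diag A B $ Inr k $ Inl l = B $ k $ l" "off_diag A B $ Inr k $ Inr l = 0"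
  by (simp_all add: off_diag_def)

lemmas gamma_defs = g1_def g2_def g3_def g4_def

lemmas spin_computation = vec_eq_iff forall_2_plus_2 forall_2 matrix_matrix_mult_def sum_2_plus_2 off_diag_nth

lemma gamma_square: "g1 ** g1 = mat 1" "g2 ** g2 = mat 1" "g3 ** g3 = mat 1" "g4 ** g4 = mat 1"
  by (simp_all add: gamma_defs spin_computation mat_def)

text \<open>Oriented as rewrite rules: with \<open>gamma_square\<close>, simplification sorts every
  quadratic expression into multiples of \<open>mat 1\<close> and of bivectors with increasing
  indices.\<close>

lemma gamma_anticommute:
  "g2 ** g1 = - (g1 ** g2)" "g3 ** g1 = - (g1 ** g3)" "g4 ** g1 = - (g1 ** g4)"
  "g3 ** g2 = - (g2 ** g3)" "g4 ** g2 = - (g2 ** g4)" "g4 ** g3 = - (g3 ** g4)"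
  by (simp_all add: gamma_defs spin_computation)

lemma trace_bivector:
  "trace (g1 ** g2) = 0" "trace (g1 ** g3) = 0" "trace (g1 ** g4) = 0"
  "trace (g2 ** g3) = 0" "trace (g2 ** g4) = 0" "trace (g3 ** g4) = 0"
  by (simp_all add: gamma_defs spin_computation trace_def)

lemma trace_one: "trace (mat 1 :: spin) = 4"
  by (simp add: trace_def sum_2_plus_2 mat_def)

text \<open>Bivectors square to \<open>- mat 1\<close>, and products of two different ones have
  trace 0, so the trace of the square is a diagonal quadratic form. There is no
  \<open>g3 ** g4\<close> because \<open>p1\<close> has no such part.\<close>

lemma trace_square:
  fixes l c12 c13 c14 c23 c24 :: real
  defines "M \<equiv> l *\<^sub>R mat 1 + c12 *\<^sub>R (g1 ** g2) + c13 *\<^sub>R (g1 ** g3) + c14 *\<^sub>R (g1 ** g4)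
    + c23 *\<^sub>R (g2 ** g3) + c24 *\<^sub>R (g2 ** g4)"
  shows "trace (M ** M) = of_real (4 * (l\<^sup>2 - c12\<^sup>2 - c13\<^sup>2 - c14\<^sup>2 - c23\<^sup>2 - c24\<^sup>2))"
  by (simp add: M_def gamma_defs spin_computation trace_def mat_def scaleR_conv_of_real[where 'a = complex])
     (simp add: power2_eq_square algebra_simps)

lemma q1_eq:
  "q1 a x \<xi> = \<xi> $ 1 *\<^sub>R g1 + (\<xi> $ 2 / a (x $ 1)) *\<^sub>R g2 + (csc (x $ 2) * \<xi> $ 3 / a (x $ 1)) *\<^sub>R g3
     + (sec (x $ 2) * \<xi> $ 4 / a (x $ 1)) *\<^sub>R g4"
  by (simp add: q1_def gamma_defs spin_computation A1_def B1_def scaleR_conv_of_real[where 'a = complex]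
      add_divide_distrib diff_divide_distrib)

text \<open>The real coefficients are half the logarithmic derivatives of the volume density
  \<open>a^3 sin \<eta> cos \<eta>\<close>, taken in \<open>t\<close> and, divided by
  \<open>a\<close>, in \<eta>. With \<open>- \<i>\<close> split off they can be differentiated as
  real functions.\<close>

lemma q0_eq:
  "q0 a x \<xi> = cscale (- \<i>) ((3 * deriv a (x $ 1) / (2 * a (x $ 1))) *\<^sub>R g1
     + ((cot (x $ 2) - tan (x $ 2)) / (2 * a (x $ 1))) *\<^sub>R g2)"
proof -
  have i: "\<i> * (z * \<i>) = - z" for z
    by (simp add: mult.commute[of z])
  have j: "- ((u - v) / w) = (v - u) / w" for u v w :: complex
    by (metis minus_diff_eq minus_divide_left)
  show ?thesis
    by (simp add: q0_def gamma_defs spin_computation A0_def B0_def cscale_def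
        scaleR_conv_of_real[where 'a = complex] mult.left_commute i j)
qed

section \<open>Multi-indices\<close>

lemma mi_abs_4: "mi_abs \<beta> = \<beta> $ 1 + \<beta> $ 2 + \<beta> $ 3 + \<beta> $ 4"
  by (simp add: mi_abs_def sum_4)

lemma finite_mi_abs: "finite {\<beta>. mi_abs \<beta> = n}"
proof (rule finite_subset)
  show "{\<beta>. mi_abs \<beta> = n} \<subseteq> (\<lambda>(i, j, k, l). vector [i, j, k, l]) ` ({..n} \<times> {..n} \<times> {..n} \<times> {..n})"
  proof
    fix \<beta> assume "\<beta> \<in> {\<beta>. mi_abs \<beta> = n}"
    then have "\<beta> = (\<lambda>(i, j, k, l). vector [i, j, k, l]) (\<beta> $ 1, \<beta> $ 2, \<beta> $ 3, \<beta> $ 4)"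
      "(\<beta> $ 1, \<beta> $ 2, \<beta> $ 3, \<beta> $ 4) \<in> {..n} \<times> {..n} \<times> {..n} \<times> {..n}"
      by (auto simp: mi_abs_4 vec_eq_iff forall_4)
    then show "\<beta> \<in> (\<lambda>(i, j, k, l). vector [i, j, k, l]) ` ({..n} \<times> {..n} \<times> {..n} \<times> {..n})"
      by (rule image_eqI)
  qed
qed simp

lemma mi_abs_eq_0: "{\<beta>. mi_abs \<beta> = 0} = {vector [0, 0, 0, 0]}"
  by (auto simp: mi_abs_4 vec_eq_iff forall_4)

text \<open>Meant for summands that vanish as soon as \<beta> differentiates in an angle \<phi>1 or
  \<phi>2; only multi-indices in \<open>t\<close> and \<eta> remain.\<close>

lemma sum_mi_abs_1:
  fixes f :: "nat^4 \<Rightarrow> 'a::comm_monoid_add"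
  assumes "\<And>\<beta>. \<beta> $ 3 > 0 \<or> \<beta> $ 4 > 0 \<Longrightarrow> f \<beta> = 0"
  shows "(\<Sum>\<beta> | mi_abs \<beta> = 1. f \<beta>) = f (vector [1, 0, 0, 0]) + f (vector [0, 1, 0, 0])"
proof -
  have "(\<Sum>\<beta> | mi_abs \<beta> = 1. f \<beta>) = (\<Sum>\<beta>\<in>{vector [1, 0, 0, 0], vector [0, 1, 0, 0]}. f \<beta>)"
  proof (rule sum.mono_neutral_right[OF finite_mi_abs])
    show "\<forall>\<beta>\<in>{\<beta>. mi_abs \<beta> = 1} - {vector [1, 0, 0, 0], vector [0, 1, 0, 0]}. f \<beta> = 0"
    proof
      fix \<beta> assume \<beta>: "\<beta> \<in> {\<beta>. mi_abs \<beta> = 1} - {vector [1, 0, 0, 0], vector [0, 1, 0, 0]}"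
      show "f \<beta> = 0"
      proof (rule assms, rule ccontr)
        assume "\<not> (\<beta> $ 3 > 0 \<or> \<beta> $ 4 > 0)"
        with \<beta> show False by (auto simp: mi_abs_4 vec_eq_iff forall_4)
      qed
    qed
  qed (auto simp: mi_abs_4)
  then show ?thesis by (simp add: vec_eq_iff forall_4)
qed

lemma sum_mi_abs_2:
  fixes f :: "nat^4 \<Rightarrow> 'a::comm_monoid_add"
  assumes "\<And>\<beta>. \<beta> $ 3 > 0 \<or> \<beta> $ 4 > 0 \<Longrightarrow> f \<beta> = 0"
  shows "(\<Sum>\<beta> | mi_abs \<beta> = 2. f \<beta>) =
    f (vector [2, 0, 0, 0]) + (f (vector [1, 1, 0, 0]) + f (vector [0, 2, 0, 0]))"
proof -
  let ?B = "{vector [2, 0, 0, 0], vector [1, 1, 0, 0], vector [0, 2, 0, 0]} :: (nat^4) set"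
  have "(\<Sum>\<beta> | mi_abs \<beta> = 2. f \<beta>) = (\<Sum>\<beta>\<in>?B. f \<beta>)"
  proof (rule sum.mono_neutral_right[OF finite_mi_abs])
    show "\<forall>\<beta>\<in>{\<beta>. mi_abs \<beta> = 2} - ?B. f \<beta> = 0"
    proof
      fix \<beta> assume \<beta>: "\<beta> \<in> {\<beta>. mi_abs \<beta> = 2} - ?B"
      show "f \<beta> = 0"
      proof (rule assms, rule ccontr)
        assume "\<not> (\<beta> $ 3 > 0 \<or> \<beta> $ 4 > 0)"
        then have zero: "\<beta> $ 3 = 0" "\<beta> $ 4 = 0" by auto
        have eq: "\<beta> = vector [i, j, 0, 0]" if "\<beta> $ 1 = i" "\<beta> $ 2 = j" for i j
          using zero that by (simp add: vec_eq_iff forall_4)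
        have "\<beta> $ 1 + \<beta> $ 2 = 2"
          using \<beta> zero mi_abs_4[of \<beta>] by (simp only: Diff_iff mem_Collect_eq) simp
        then have "\<beta> $ 1 = 2 \<and> \<beta> $ 2 = 0 \<or> \<beta> $ 1 = 1 \<and> \<beta> $ 2 = 1 \<or> \<beta> $ 1 = 0 \<and> \<beta> $ 2 = 2"
          by arith
        then have "\<beta> \<in> ?B"
          using eq[of 2 0] eq[of 1 1] eq[of 0 2] by blast
        with \<beta> show False by blast
      qed
    qed
  qed (auto simp: mi_abs_4)
  then show ?thesis by (simp add: vec_eq_iff forall_4)
qed

lemma mi_fact_vector: "mi_fact (vector [i, j, k, l]) = fact i * fact j * fact k * fact l"
  unfolding mi_fact_def UNIV_4 by (simp add: mult.assoc)

lemma pd_zero: "pd_x j (\<lambda>x \<xi>. 0) = (\<lambda>x \<xi>. 0)"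
  by (simp add: pd_x_def)

lemma pd_x_funpow_zero: "(pd_x j ^^ n) (\<lambda>x \<xi>. 0) = (\<lambda>x \<xi>. 0)"
  by (induction n) (simp_all add: pd_zero)

text \<open>Phrased by values instead of by vanishing partial derivatives, so that it passes to
  \<open>pd_x\<close> and \<open>pd_xi\<close> without any differentiability: equal functions of
  \<open>h\<close> have equal \<open>vector_derivative\<close>.\<close>

definition depends_on_12 :: "symbol \<Rightarrow> bool" where
  "depends_on_12 s \<longleftrightarrow> (\<forall>x y \<xi>. x $ 1 = y $ 1 \<longrightarrow> x $ 2 = y $ 2 \<longrightarrow> s x \<xi> = s y \<xi>)"

lemma depends_on_12D: "depends_on_12 s \<Longrightarrow> x $ 1 = y $ 1 \<Longrightarrow> x $ 2 = y $ 2 \<Longrightarrow> s x \<xi> = s y \<xi>"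
  unfolding depends_on_12_def by blast

lemma pd_x_independent:
  assumes "depends_on_12 s" "j = 3 \<or> j = 4"
  shows "pd_x j s = (\<lambda>x \<xi>. 0)"
proof -
  have "s (x + h *\<^sub>R axis j 1) \<xi> = s x \<xi>" for x h \<xi>
    using assms(2) by (intro depends_on_12D[OF assms(1)]) (auto simp: axis_def)
  then show ?thesis by (simp add: pd_x_def)
qed

lemma depends_on_12_q1: "depends_on_12 (q1 a)"
  unfolding depends_on_12_def by (simp add: q1_eq)

lemma depends_on_12_q0: "depends_on_12 (q0 a)"
  unfolding depends_on_12_def by (simp add: q0_eq)

lemma depends_on_12_pd_x:
  assumes "depends_on_12 s"
  shows "depends_on_12 (pd_x j s)"
  unfolding depends_on_12_def
proof (intro allI impI)
  fix x y :: "real^4" and \<xi> :: "real^4"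
  assume "x $ 1 = y $ 1" "x $ 2 = y $ 2"
  then have "s (x + h *\<^sub>R axis j 1) \<xi> = s (y + h *\<^sub>R axis j 1) \<xi>" for h
    by (intro depends_on_12D[OF assms(1)]) auto
  then show "pd_x j s x \<xi> = pd_x j s y \<xi>"
    by (simp add: pd_x_def)
qed

lemma depends_on_12_pd_xi:
  assumes "depends_on_12 s"
  shows "depends_on_12 (pd_xi j s)"
  unfolding depends_on_12_def
proof (intro allI impI)
  fix x y :: "real^4" and \<xi> :: "real^4"
  assume "x $ 1 = y $ 1" "x $ 2 = y $ 2"
  then have "s x \<zeta> = s y \<zeta>" for \<zeta>
    by (intro depends_on_12D[OF assms(1)]) auto
  then show "pd_xi j s x \<xi> = pd_xi j s y \<xi>"
    by (simp add: pd_xi_def)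
qed

lemma depends_on_12_dirac_sq_symbol: "depends_on_12 (dirac_sq_symbol a k)"
  unfolding depends_on_12_def
proof (intro allI impI)
  fix x y \<xi> :: "real^4"
  assume xy: "x $ 1 = y $ 1" "x $ 2 = y $ 2"
  have "p0 a x \<xi> = p0 a y \<xi> \<and> p1 a x \<xi> = p1 a y \<xi> \<and> p2 a x \<xi> = p2 a y \<xi>"
    using depends_on_12D[OF depends_on_12_q0 xy, of a] depends_on_12D[OF depends_on_12_q1 xy, of a]
      depends_on_12D[OF depends_on_12_pd_x[OF depends_on_12_q0] xy, of _ a]
      depends_on_12D[OF depends_on_12_pd_x[OF depends_on_12_q1] xy, of _ a]
      depends_on_12D[OF depends_on_12_pd_xi[OF depends_on_12_q1] xy, of _ a]
    by (simp add: p0_def p1_def p2_def)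
  then show "dirac_sq_symbol a k x \<xi> = dirac_sq_symbol a k y \<xi>"
    by (simp add: dirac_sq_symbol_def)
qed

text \<open>\<open>mpd_x\<close> applies the \<phi>2-derivatives first and the \<phi>1-derivatives
  next, so the symbol is already 0 before \<open>t\<close> and \<eta> are touched, and no partial
  derivatives have to be interchanged.\<close>

lemma mpd_x_dirac_sq_symbol_eq_0:
  assumes "\<beta> $ 3 > 0 \<or> \<beta> $ 4 > 0"
  shows "mpd_x \<beta> (dirac_sq_symbol a k) = (\<lambda>x \<xi>. 0)"
proof -
  let ?s = "dirac_sq_symbol a k"
  have "(pd_x 3 ^^ (\<beta> $ 3)) ((pd_x 4 ^^ (\<beta> $ 4)) ?s) = (\<lambda>x \<xi>. 0)"
  proof (cases "\<beta> $ 4")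
    case 0
    with assms obtain n where "\<beta> $ 3 = Suc n" by (auto simp: gr0_conv_Suc)
    with 0 show ?thesis
      by (simp add: funpow_swap1 pd_x_independent depends_on_12_dirac_sq_symbol pd_x_funpow_zero)
  next
    case (Suc n)
    then show ?thesis
      by (simp add: funpow_swap1 pd_x_independent depends_on_12_dirac_sq_symbol pd_x_funpow_zero)
  qed
  then show ?thesis by (simp add: mpd_x_def pd_x_funpow_zero)
qed

section \<open>Derivatives of symbols\<close>

lemma vector_derivative_cong_open:
  fixes f g :: "real \<Rightarrow> 'b::real_normed_vector"
  assumes "open S" "0 \<in> S" "\<And>h. h \<in> S \<Longrightarrow> f h = g h" "(g has_vector_derivative D) (at 0)"
  shows "vector_derivative f (at 0) = D"
  using has_vector_derivative_transform_within_open[OF assms(4,1,2)] assms(3)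
  by (intro vector_derivative_at) auto

lemma trace_has_vector_derivative:
  assumes "(f has_vector_derivative D) (at x)"
  shows "((\<lambda>h. trace (f h :: complex^'n::finite^'n)) has_vector_derivative trace D) (at x)"
  by (rule bounded_linear.has_vector_derivative[OF bounded_linear_trace assms])

lemma open_line: "open U \<Longrightarrow> open {h. x + h *\<^sub>R v \<in> U}" for x v :: "'a::real_normed_vector"
  using open_vimage[of U "\<lambda>h. x + h *\<^sub>R v"] by (simp add: vimage_def continuous_on_add continuous_on_scaleR continuous_on_const continuous_on_id)

text \<open>A closed formula \<open>f\<close> on a neighbourhood is enough. This allows iteration: a
  derivative computed at every point of an open set is again a closed formula there.\<close>

lemma pd_x_eq:
  assumes "open U" "x \<in> U" "\<And>y. y \<in> U \<Longrightarrow> s y \<xi> = f y"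
    "((\<lambda>h. f (x + h *\<^sub>R axis j 1)) has_vector_derivative D) (at 0)"
  shows "pd_x j s x \<xi> = D"
  unfolding pd_x_def
  by (rule vector_derivative_cong_open[OF open_line[OF assms(1)] _ _ assms(4)]) (use assms(2,3) in auto)

lemma pd_xi_eq:
  assumes "\<xi> \<noteq> 0" "\<And>\<zeta>. \<zeta> \<noteq> 0 \<Longrightarrow> s x \<zeta> = f \<zeta>"
    "((\<lambda>h. f (\<xi> + h *\<^sub>R axis j 1)) has_vector_derivative D) (at 0)"
  shows "pd_xi j s x \<xi> = D"
proof -
  have U: "open (- {0 :: real^4})" by (simp add: open_Compl)
  show ?thesis
    unfolding pd_xi_def
    by (rule vector_derivative_cong_open[OF open_line[OF U] _ _ assms(3)]) (use assms(1,2) in auto)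
qed

lemma has_vector_derivative_scaleR_const:
  fixes M :: "'b::real_normed_vector"
  assumes "(f has_real_derivative D) (at x)"
  shows "((\<lambda>h. f h *\<^sub>R M) has_vector_derivative D *\<^sub>R M) (at x)"
  using has_vector_derivative_scaleR[OF assms has_vector_derivative_const[of M]] by simp

lemma bounded_linear_cscale: "bounded_linear (cscale c :: complex^'n::finite^'m::finite \<Rightarrow> _)"
proof -
  have "linear (cscale c :: complex^'n::finite^'m::finite \<Rightarrow> _)"
    by (rule linearI) (simp_all add: cscale_simps)
  then show ?thesis by (simp add: linear_conv_bounded_linear)
qed

section \<open>Coefficient functions of the metric and their derivatives\<close>

locale robertson_walker =
  fixes a :: "real \<Rightarrow> real" and I :: "real set"
  assumes open_I: "open I" and pos: "\<And>t. t \<in> I \<Longrightarrow> a t > 0" and smooth: "smooth_on_open I a"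
begin

definition U :: "(real^4) set" where
  "U = {x. x $ 1 \<in> I \<and> x $ 2 \<in> {0<..<pi/2}}"

text \<open>Dividing by \<open>a\<close> makes the derivatives in \<open>t\<close> and \<eta>
  polynomial in these seven functions again, as far as they occur: \<open>acc\<close> is never
  differentiated in \<open>t\<close>.\<close>

definition b :: "real^4 \<Rightarrow> real" where "b x = 1 / a (x $ 1)"
definition hub :: "real^4 \<Rightarrow> real" where "hub x = deriv a (x $ 1) / a (x $ 1)"
definition acc :: "real^4 \<Rightarrow> real" where "acc x = deriv (deriv a) (x $ 1) / a (x $ 1)"
definition ct :: "real^4 \<Rightarrow> real" where "ct x = cot (x $ 2)"
definition tn :: "real^4 \<Rightarrow> real" where "tn x = tan (x $ 2)"
definition cs :: "real^4 \<Rightarrow> real" where "cs x = csc (x $ 2)"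
definition sc :: "real^4 \<Rightarrow> real" where "sc x = sec (x $ 2)"

lemmas coordinate_defs = b_def hub_def acc_def ct_def tn_def cs_def sc_def

lemma open_U: "open U"
proof -
  have "open ((\<lambda>x :: real^4. x $ 1) -` I \<inter> (\<lambda>x. x $ 2) -` {0<..<pi/2})"
    by (intro open_Int open_vimage open_I continuous_intros)
  then show ?thesis by (simp add: U_def vimage_def Collect_conj_eq)
qed

lemma differentiable:
  assumes "t \<in> I"
  shows "a differentiable (at t)" "deriv a differentiable (at t)" "deriv (deriv a) differentiable (at t)"
proof -
  have "(deriv ^^ n) a differentiable (at t)" for n
    using smooth assms unfolding smooth_on_open_def by blast
  from this[of 0] this[of 1] this[of 2]
  show "a differentiable (at t)" "deriv a differentiable (at t)" "deriv (deriv a) differentiable (at t)"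
    by (simp_all add: numeral_2_eq_2)
qed

lemma trig_pos:
  assumes "x \<in> U"
  shows "sin (x $ 2) > 0" "cos (x $ 2) > 0"
  using assms by (auto simp: U_def intro!: sin_gt_zero cos_gt_zero)

lemma csc_squared: "x \<in> U \<Longrightarrow> (cs x)\<^sup>2 = 1 + (ct x)\<^sup>2"
  and sec_squared: "x \<in> U \<Longrightarrow> (sc x)\<^sup>2 = 1 + (tn x)\<^sup>2"
  and cot_times_tan: "x \<in> U \<Longrightarrow> ct x * tn x = 1"
  using trig_pos[of x] sin_cos_squared_add[of "x $ 2"]
  by (auto simp: coordinate_defs csc_def sec_def cot_def tan_def field_simps power2_eq_square)

lemma derivative_along_1:
  assumes "x \<in> U"
  shows "((\<lambda>h. b (x + h *\<^sub>R axis 1 1)) has_real_derivative - hub x * b x) (at 0)"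
    "((\<lambda>h. hub (x + h *\<^sub>R axis 1 1)) has_real_derivative acc x - (hub x)\<^sup>2) (at 0)"
proof -
  have t: "x $ 1 \<in> I" using assms by (simp add: U_def)
  have shift: "((\<lambda>h. f (x $ 1 + h)) has_real_derivative deriv f (x $ 1)) (at 0)"
    if "f differentiable (at (x $ 1))" for f :: "real \<Rightarrow> real"
    using that DERIV_shift[of f "deriv f (x $ 1)" 0 "x $ 1"]
    by (simp add: DERIV_deriv_iff_real_differentiable add.commute)
  note d = shift[OF differentiable(1)[OF t]] shift[OF differentiable(2)[OF t]]
  note d' = d[unfolded add.commute[of "x $ 1"]]
  have "a (x $ 1) \<noteq> 0" using pos[OF t] by simp
  then show "((\<lambda>h. b (x + h *\<^sub>R axis 1 1)) has_real_derivative - hub x * b x) (at 0)"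
    "((\<lambda>h. hub (x + h *\<^sub>R axis 1 1)) has_real_derivative acc x - (hub x)\<^sup>2) (at 0)"
    unfolding coordinate_defs
    by (auto intro!: derivative_eq_intros d d' simp: field_simps power2_eq_square)
qed

lemma constant_along_1 [simp]:
  "ct (x + h *\<^sub>R axis 1 1) = ct x" "tn (x + h *\<^sub>R axis 1 1) = tn x"
  "cs (x + h *\<^sub>R axis 1 1) = cs x" "sc (x + h *\<^sub>R axis 1 1) = sc x"
  by (simp_all add: coordinate_defs axis_def)

lemma constant_along_2 [simp]:
  "b (x + h *\<^sub>R axis 2 1) = b x" "hub (x + h *\<^sub>R axis 2 1) = hub x" "acc (x + h *\<^sub>R axis 2 1) = acc x"
  by (simp_all add: coordinate_defs axis_def)

lemma derivative_along_2:
  assumes "x \<in> U"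
  shows "((\<lambda>h. ct (x + h *\<^sub>R axis 2 1)) has_real_derivative - (1 + (ct x)\<^sup>2)) (at 0)"
    "((\<lambda>h. tn (x + h *\<^sub>R axis 2 1)) has_real_derivative 1 + (tn x)\<^sup>2) (at 0)"
    "((\<lambda>h. cs (x + h *\<^sub>R axis 2 1)) has_real_derivative - (cs x * ct x)) (at 0)"
    "((\<lambda>h. sc (x + h *\<^sub>R axis 2 1)) has_real_derivative sc x * tn x) (at 0)"
proof -
  have nz: "sin (x $ 2) \<noteq> 0" "cos (x $ 2) \<noteq> 0"
    using trig_pos[OF assms] by auto
  show "((\<lambda>h. ct (x + h *\<^sub>R axis 2 1)) has_real_derivative - (1 + (ct x)\<^sup>2)) (at 0)"
    unfolding coordinate_defs cot_def using nz sin_cos_squared_add3[of "x $ 2"]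
    by (auto intro!: derivative_eq_intros simp: field_simps power2_eq_square)
       (use sin_cos_squared_add3[of "x $ 2"] in algebra)
  show "((\<lambda>h. tn (x + h *\<^sub>R axis 2 1)) has_real_derivative 1 + (tn x)\<^sup>2) (at 0)"
    "((\<lambda>h. cs (x + h *\<^sub>R axis 2 1)) has_real_derivative - (cs x * ct x)) (at 0)"
    "((\<lambda>h. sc (x + h *\<^sub>R axis 2 1)) has_real_derivative sc x * tn x) (at 0)"
    unfolding coordinate_defs cot_def tan_def csc_def sec_def
    using nz by (auto intro!: derivative_eq_intros simp: field_simps power2_eq_square)
qed

section \<open>The symbol of the square of the Dirac operator\<close>

text \<open>
  \<open>P\<close> is the squared norm of \<open>\<xi>\<close>, with \<open>csc\<^sup>2\<close> and \<open>sec\<^sup>2\<close> written as \<open>1 + cot\<^sup>2\<close> and \<open>1 + tan\<^sup>2\<close>. \<open>K\<close> and \<open>K'\<close> are the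
  first two derivatives of \<open>W\<close> in \<open>\<eta>\<close>; \<open>- \<i> L\<close> is the scalar part of \<open>p1\<close>.
\<close>

definition W :: "real^4 \<Rightarrow> real^4 \<Rightarrow> real" where
  "W x \<xi> = (\<xi> $ 2)\<^sup>2 + ((1 + (ct x)\<^sup>2) * (\<xi> $ 3)\<^sup>2 + (1 + (tn x)\<^sup>2) * (\<xi> $ 4)\<^sup>2)"

definition P :: "real^4 \<Rightarrow> real^4 \<Rightarrow> real" where
  "P x \<xi> = (\<xi> $ 1)\<^sup>2 + (b x)\<^sup>2 * W x \<xi>"

definition K :: "real^4 \<Rightarrow> real^4 \<Rightarrow> real" where
  "K x \<xi> = 2 * (tn x * ((1 + (tn x)\<^sup>2) * (\<xi> $ 4)\<^sup>2) - ct x * ((1 + (ct x)\<^sup>2) * (\<xi> $ 3)\<^sup>2))"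

definition K' :: "real^4 \<Rightarrow> real^4 \<Rightarrow> real" where
  "K' x \<xi> = (2 + 6 * (ct x)\<^sup>2) * ((1 + (ct x)\<^sup>2) * (\<xi> $ 3)\<^sup>2) + (2 + 6 * (tn x)\<^sup>2) * ((1 + (tn x)\<^sup>2) * (\<xi> $ 4)\<^sup>2)"

definition L :: "real^4 \<Rightarrow> real^4 \<Rightarrow> real" where
  "L x \<xi> = 3 * hub x * \<xi> $ 1 + (ct x - tn x) * (b x)\<^sup>2 * \<xi> $ 2"

lemma q1_combination:
  "q1 a x \<xi> = \<xi> $ 1 *\<^sub>R g1 + (b x * \<xi> $ 2) *\<^sub>R g2 + (b x * cs x * \<xi> $ 3) *\<^sub>R g3 + (b x * sc x * \<xi> $ 4) *\<^sub>R g4"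
  by (simp add: q1_eq coordinate_defs)

lemma q0_combination:
  "q0 a x \<xi> = cscale (- \<i>) ((3 / 2 * hub x) *\<^sub>R g1 + (b x * (ct x - tn x) / 2) *\<^sub>R g2)"
  by (simp add: q0_eq coordinate_defs mult.commute)

lemma pd_x_q1:
  assumes "x \<in> U"
  shows "pd_x 1 (q1 a) x \<xi> = (- hub x * b x) *\<^sub>R (\<xi> $ 2 *\<^sub>R g2 + (cs x * \<xi> $ 3) *\<^sub>R g3 + (sc x * \<xi> $ 4) *\<^sub>R g4)"
    "pd_x 2 (q1 a) x \<xi> = (- b x * cs x * ct x * \<xi> $ 3) *\<^sub>R g3 + (b x * sc x * tn x * \<xi> $ 4) *\<^sub>R g4"
proof -
  show "pd_x 1 (q1 a) x \<xi> = (- hub x * b x) *\<^sub>R (\<xi> $ 2 *\<^sub>R g2 + (cs x * \<xi> $ 3) *\<^sub>R g3 + (sc x * \<xi> $ 4) *\<^sub>R g4)"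
    by (rule pd_x_eq[OF open_U assms q1_combination])
       (auto intro!: derivative_eq_intros derivative_along_1 assms simp: algebra_simps)
  show "pd_x 2 (q1 a) x \<xi> = (- b x * cs x * ct x * \<xi> $ 3) *\<^sub>R g3 + (b x * sc x * tn x * \<xi> $ 4) *\<^sub>R g4"
    by (rule pd_x_eq[OF open_U assms q1_combination])
       (auto intro!: derivative_eq_intros derivative_along_2 assms simp: algebra_simps)
qed

lemma pd_xi_q1: "pd_xi 1 (q1 a) x \<xi> = g1" "pd_xi 2 (q1 a) x \<xi> = b x *\<^sub>R g2"
proof -
  show "pd_xi 1 (q1 a) x \<xi> = g1"
    unfolding pd_xi_def q1_combination
    by (rule vector_derivative_at) (auto intro!: derivative_eq_intros simp: axis_def)
  show "pd_xi 2 (q1 a) x \<xi> = b x *\<^sub>R g2"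
    unfolding pd_xi_def q1_combination
    by (rule vector_derivative_at) (auto intro!: derivative_eq_intros simp: axis_def)
qed

lemma pd_x_q0:
  assumes "x \<in> U"
  shows "pd_x 1 (q0 a) x \<xi> = cscale (- \<i>) ((3 / 2 * (acc x - (hub x)\<^sup>2)) *\<^sub>R g1
      + (- hub x * b x * (ct x - tn x) / 2) *\<^sub>R g2)"
    "pd_x 2 (q0 a) x \<xi> = cscale (- \<i>) ((- b x * (2 + (ct x)\<^sup>2 + (tn x)\<^sup>2) / 2) *\<^sub>R g2)"
proof -
  show "pd_x 1 (q0 a) x \<xi> = cscale (- \<i>) ((3 / 2 * (acc x - (hub x)\<^sup>2)) *\<^sub>R g1
      + (- hub x * b x * (ct x - tn x) / 2) *\<^sub>R g2)"
    by (rule pd_x_eq[OF open_U assms q0_combination])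
       (intro bounded_linear.has_vector_derivative[OF bounded_linear_cscale] has_vector_derivative_add
          has_vector_derivative_scaleR_const;
        auto intro!: derivative_eq_intros derivative_along_1 assms simp: field_simps)
  have "pd_x 2 (q0 a) x \<xi> = cscale (- \<i>) (0 *\<^sub>R g1 + (- b x * (2 + (ct x)\<^sup>2 + (tn x)\<^sup>2) / 2) *\<^sub>R g2)"
    by (rule pd_x_eq[OF open_U assms q0_combination])
       (intro bounded_linear.has_vector_derivative[OF bounded_linear_cscale] has_vector_derivative_add
          has_vector_derivative_scaleR_const;
        auto intro!: derivative_eq_intros derivative_along_2 assms simp: field_simps)
  then show "pd_x 2 (q0 a) x \<xi> = cscale (- \<i>) ((- b x * (2 + (ct x)\<^sup>2 + (tn x)\<^sup>2) / 2) *\<^sub>R g2)"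
    by simp
qed

lemma p2_eq:
  assumes "x \<in> U"
  shows "p2 a x \<xi> = P x \<xi> *\<^sub>R mat 1"
proof -
  have "p2 a x \<xi> = ((\<xi> $ 1)\<^sup>2 + (b x * \<xi> $ 2)\<^sup>2 + (b x * cs x * \<xi> $ 3)\<^sup>2 + (b x * sc x * \<xi> $ 4)\<^sup>2) *\<^sub>R mat 1"
    unfolding p2_def q1_combination
    by (simp add: matrix_bilinear gamma_square gamma_anticommute)
       (simp add: algebra_simps power2_eq_square)
  also have "(\<xi> $ 1)\<^sup>2 + (b x * \<xi> $ 2)\<^sup>2 + (b x * cs x * \<xi> $ 3)\<^sup>2 + (b x * sc x * \<xi> $ 4)\<^sup>2 = P x \<xi>"
    unfolding P_def W_def power_mult_distrib csc_squared[OF assms] sec_squared[OF assms]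
    by (simp add: algebra_simps)
  finally show ?thesis .
qed

lemma sum_UNIV_pd:
  "(\<Sum>j\<in>UNIV. pd_xi j (q1 a) x \<xi> ** pd_x j s x \<xi>) =
    pd_xi 1 (q1 a) x \<xi> ** pd_x 1 s x \<xi> + pd_xi 2 (q1 a) x \<xi> ** pd_x 2 s x \<xi>"
  if "depends_on_12 s"
  using that by (simp add: sum_4 pd_x_independent)

text \<open>Up to the factor \<open>- \<i>\<close> of \<open>q0\<close>, both \<open>q0\<close> and
  \<open>q1\<close> are Clifford vectors, so their anticommutator is scalar and produces
  \<open>L\<close>. The bivectors come from the derivative term alone: \<open>pd_x 1 (q1 a)\<close>
  has no \<open>g1\<close> and \<open>pd_x 2 (q1 a)\<close> no \<open>g2\<close>, so that term has
  no scalar part.\<close>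

lemma p1_eq:
  assumes "x \<in> U"
  shows "p1 a x \<xi> = cscale (- \<i>) (L x \<xi> *\<^sub>R mat 1 + (- (hub x * b x * \<xi> $ 2)) *\<^sub>R (g1 ** g2)
    + (- (hub x * b x * cs x * \<xi> $ 3)) *\<^sub>R (g1 ** g3) + (- (hub x * b x * sc x * \<xi> $ 4)) *\<^sub>R (g1 ** g4)
    + (- ((b x)\<^sup>2 * cs x * ct x * \<xi> $ 3)) *\<^sub>R (g2 ** g3) + ((b x)\<^sup>2 * sc x * tn x * \<xi> $ 4) *\<^sub>R (g2 ** g4))"
  unfolding p1_def sum_UNIV_pd[OF depends_on_12_q1] pd_x_q1[OF assms] pd_xi_q1 q0_combination
    q1_combination[of x] L_def
  by (simp add: matrix_bilinear gamma_square gamma_anticommute cscale_simps)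
     (simp add: vec_eq_iff cscale_def scaleR_conv_of_real[where 'a = complex], simp add: field_simps power2_eq_square)

text \<open>The only bivector comes from the \<open>t\<close>-derivative of the \<open>g2\<close>
  coefficient of \<open>q0\<close>; it is traceless, and \<open>p0\<close> enters the final trace
  only through its own trace.\<close>

lemma p0_eq:
  assumes "x \<in> U"
  shows "p0 a x \<xi> = (- (9 / 4 * (hub x)\<^sup>2 + (b x)\<^sup>2 * (ct x - tn x)\<^sup>2 / 4) - 3 / 2 * (acc x - (hub x)\<^sup>2)
      + (b x)\<^sup>2 * (2 + (ct x)\<^sup>2 + (tn x)\<^sup>2) / 2) *\<^sub>R mat 1
    + (hub x * b x * (ct x - tn x) / 2) *\<^sub>R (g1 ** g2)"
  unfolding p0_def sum_UNIV_pd[OF depends_on_12_q0] pd_x_q0[OF assms] pd_xi_q1 q0_combination[of x]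
  by (simp add: matrix_bilinear gamma_square gamma_anticommute cscale_simps)
     (simp add: vec_eq_iff cscale_def scaleR_conv_of_real[where 'a = complex], simp add: field_simps power2_eq_square)

end

section \<open>The parametrix\<close>

definition summand :: "(real \<Rightarrow> real) \<Rightarrow> nat \<Rightarrow> nat \<Rightarrow> nat^4 \<Rightarrow> symbol" where
  "summand a j k \<beta> = (\<lambda>x \<xi>. cscale ((- \<i>) ^ mi_abs \<beta> / of_nat (mi_fact \<beta>))
     (mpd_xi \<beta> (parametrix a j) x \<xi> ** mpd_x \<beta> (dirac_sq_symbol a k) x \<xi>))"

lemma summand_eq_0: "\<beta> $ 3 > 0 \<or> \<beta> $ 4 > 0 \<Longrightarrow> summand a j k \<beta> x \<xi> = 0"
  by (simp add: summand_def mpd_x_dirac_sq_symbol_eq_0 cscale_simps)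

definition layer :: "(real \<Rightarrow> real) \<Rightarrow> nat \<Rightarrow> nat \<Rightarrow> nat \<Rightarrow> symbol" where
  "layer a N j k = (\<lambda>x \<xi>. \<Sum>\<beta> | N + k = 2 + j + mi_abs \<beta>. summand a j k \<beta> x \<xi>)"

text \<open>The side condition fixes |\<beta>| = N + k - 2 - j. For \<open>N \<le> 2\<close> and
  \<open>k \<le> 2\<close> this is at most 2, so the four cases are exhaustive.\<close>

lemma layer_eq:
  "N + k < 2 + j \<Longrightarrow> layer a N j k x \<xi> = 0"
  "N + k = 2 + j \<Longrightarrow> layer a N j k x \<xi> =
     summand a j k (vector [0, 0, 0, 0]) x \<xi>"
  "N + k = 3 + j \<Longrightarrow> layer a N j k x \<xi> =
     summand a j k (vector [1, 0, 0, 0]) x \<xi> + summand a j k (vector [0, 1, 0, 0]) x \<xi>"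
  "N + k = 4 + j \<Longrightarrow> layer a N j k x \<xi> =
     summand a j k (vector [2, 0, 0, 0]) x \<xi> +
     (summand a j k (vector [1, 1, 0, 0]) x \<xi> + summand a j k (vector [0, 2, 0, 0]) x \<xi>)"
proof -
  have sets: "N + k < 2 + j \<Longrightarrow> {\<beta>. N + k = 2 + j + mi_abs \<beta>} = {}"
    "N + k = 2 + j \<Longrightarrow> {\<beta>. N + k = 2 + j + mi_abs \<beta>} = {\<beta>. mi_abs \<beta> = 0}"
    "N + k = 3 + j \<Longrightarrow> {\<beta>. N + k = 2 + j + mi_abs \<beta>} = {\<beta>. mi_abs \<beta> = 1}"
    "N + k = 4 + j \<Longrightarrow> {\<beta>. N + k = 2 + j + mi_abs \<beta>} = {\<beta>. mi_abs \<beta> = 2}"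
    by auto
  show "N + k < 2 + j \<Longrightarrow> layer a N j k x \<xi> = 0"
    unfolding layer_def by (subst sets(1), assumption) simp
  show "N + k = 2 + j \<Longrightarrow> layer a N j k x \<xi> =
     summand a j k (vector [0, 0, 0, 0]) x \<xi>"
    unfolding layer_def by (subst sets(2), assumption) (subst mi_abs_eq_0, simp)
  show "N + k = 3 + j \<Longrightarrow> layer a N j k x \<xi> =
     summand a j k (vector [1, 0, 0, 0]) x \<xi> + summand a j k (vector [0, 1, 0, 0]) x \<xi>"
    unfolding layer_def by (subst sets(3), assumption) (rule sum_mi_abs_1, rule summand_eq_0)
  show "N + k = 4 + j \<Longrightarrow> layer a N j k x \<xi> =
     summand a j k (vector [2, 0, 0, 0]) x \<xi> +
     (summand a j k (vector [1, 1, 0, 0]) x \<xi> + summand a j k (vector [0, 2, 0, 0]) x \<xi>)"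
    unfolding layer_def by (subst sets(4), assumption) (rule sum_mi_abs_2, rule summand_eq_0)
qed

lemma parametrix_0: "parametrix a 0 = (\<lambda>x \<xi>. matrix_inv (p2 a x \<xi>))"
  by (subst parametrix.simps) simp

lemma parametrix_rec:
  assumes "N > 0"
  shows "parametrix a N x \<xi> =
    - (\<Sum>j<N. \<Sum>k\<le>2. layer a N j k x \<xi>) ** matrix_inv (p2 a x \<xi>)"
  using assms by (subst parametrix.simps) (simp add: layer_def summand_def)

lemma sum_atMost_2: "(\<Sum>k\<le>2. f k) = f 0 + (f 1 + f (2::nat))"
  by (simp add: numeral_2_eq_2 add.assoc)

lemma parametrix_1:
  "parametrix a 1 x \<xi> = - (summand a 0 1 (vector [0, 0, 0, 0]) x \<xi> +
     (summand a 0 2 (vector [1, 0, 0, 0]) x \<xi> + summand a 0 2 (vector [0, 1, 0, 0]) x \<xi>)) ** matrix_inv (p2 a x \<xi>)"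
proof -
  have "(\<Sum>j<1. f j) = f 0" for f :: "nat \<Rightarrow> spin" by simp
  then show ?thesis
    by (subst parametrix_rec) (simp_all add: sum_atMost_2 layer_eq)
qed

text \<open>Nine summands survive: the pair \<open>j = 1\<close>, \<open>k = 0\<close> would need
  |\<beta>| = -1.\<close>

lemma parametrix_2:
  "parametrix a 2 x \<xi> = - (summand a 0 0 (vector [0, 0, 0, 0]) x \<xi> +
     (summand a 0 1 (vector [1, 0, 0, 0]) x \<xi> + summand a 0 1 (vector [0, 1, 0, 0]) x \<xi>) +
     (summand a 0 2 (vector [2, 0, 0, 0]) x \<xi> +
      (summand a 0 2 (vector [1, 1, 0, 0]) x \<xi> + summand a 0 2 (vector [0, 2, 0, 0]) x \<xi>)) +
     (summand a 1 1 (vector [0, 0, 0, 0]) x \<xi> +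
     (summand a 1 2 (vector [1, 0, 0, 0]) x \<xi> + summand a 1 2 (vector [0, 1, 0, 0]) x \<xi>))) ** matrix_inv (p2 a x \<xi>)"
proof -
  have "(\<Sum>j<2. f j) = f 0 + f 1" for f :: "nat \<Rightarrow> spin" by (simp add: numeral_2_eq_2)
  then show ?thesis
    by (subst parametrix_rec) (simp_all add: sum_atMost_2 layer_eq add.assoc)
qed

lemma mpd_vector:
  "mpd_x (vector [0, 0, 0, 0]) s = s" "mpd_xi (vector [0, 0, 0, 0]) s = s"
  "mpd_x (vector [1, 0, 0, 0]) s = pd_x 1 s" "mpd_xi (vector [1, 0, 0, 0]) s = pd_xi 1 s"
  "mpd_x (vector [0, 1, 0, 0]) s = pd_x 2 s" "mpd_xi (vector [0, 1, 0, 0]) s = pd_xi 2 s"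
  "mpd_x (vector [2, 0, 0, 0]) s = pd_x 1 (pd_x 1 s)" "mpd_xi (vector [2, 0, 0, 0]) s = pd_xi 1 (pd_xi 1 s)"
  "mpd_x (vector [1, 1, 0, 0]) s = pd_x 1 (pd_x 2 s)" "mpd_xi (vector [1, 1, 0, 0]) s = pd_xi 1 (pd_xi 2 s)"
  "mpd_x (vector [0, 2, 0, 0]) s = pd_x 2 (pd_x 2 s)" "mpd_xi (vector [0, 2, 0, 0]) s = pd_xi 2 (pd_xi 2 s)"
  by (simp_all add: mpd_x_def mpd_xi_def numeral_2_eq_2)

lemma mi_abs_vector: "mi_abs (vector [i, j, k, l]) = i + j + k + l"
  by (simp add: mi_abs_4)

text \<open>For a matrix function known to be differentiable, the derivative of its trace may be
  computed from a scalar formula valid near 0; the entries need not be differentiated. The constant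
  \<open>c\<close> absorbs factors such as \<i>, so that \<open>g\<close> is real.\<close>

lemma has_trace_vector_derivative:
  fixes f :: "real \<Rightarrow> spin"
  assumes "f differentiable (at 0)" "\<And>h. h \<in> S \<Longrightarrow> trace (f h) = c * of_real (g h)" "open S" "0 \<in> S"
    "(g has_real_derivative g') (at 0)"
  shows "trace (vector_derivative f (at 0)) = c * of_real g'"
proof -
  have "((\<lambda>h. trace (f h)) has_vector_derivative trace (vector_derivative f (at 0))) (at 0)"
    using assms(1) by (intro trace_has_vector_derivative) (simp add: vector_derivative_works)
  moreover have "((\<lambda>h. trace (f h)) has_vector_derivative c * of_real g') (at 0)"
    by (rule has_vector_derivative_transform_within_open[OF _ assms(3,4)])
       (use assms(2,5) in \<open>auto intro!: derivative_eq_intros\<close>)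
  ultimately show ?thesis by (rule vector_derivative_unique_at)
qed

lemma trace_pd_x_eq:
  assumes "open V" "x \<in> V" "\<And>y. y \<in> V \<Longrightarrow> s y \<xi> = f y"
    "(\<lambda>h. f (x + h *\<^sub>R axis j 1)) differentiable (at 0)"
    "\<And>y. y \<in> V \<Longrightarrow> trace (s y \<xi>) = c * of_real (g y)"
    "((\<lambda>h. g (x + h *\<^sub>R axis j 1)) has_real_derivative g') (at 0)"
  shows "trace (pd_x j s x \<xi>) = c * of_real g'"
proof -
  have "pd_x j s x \<xi> = vector_derivative (\<lambda>h. f (x + h *\<^sub>R axis j 1)) (at 0)"
    by (rule pd_x_eq[where s = s and f = f, OF assms(1-3)]) (use assms(4) in \<open>simp_all add: vector_derivative_works\<close>)
  then show ?thesis
    using has_trace_vector_derivative[OF assms(4) _ open_line[OF assms(1), of x "axis j 1"], where c = c and g = "\<lambda>h. g (x + h *\<^sub>R axis j 1)"]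
      assms(2,3,5,6) by simp
qed

lemma trace_pd_xi_eq:
  assumes "\<xi> \<noteq> 0" "\<And>\<zeta>. \<zeta> \<noteq> 0 \<Longrightarrow> s x \<zeta> = f \<zeta>"
    "(\<lambda>h. f (\<xi> + h *\<^sub>R axis j 1)) differentiable (at 0)"
    "\<And>\<zeta>. \<zeta> \<noteq> 0 \<Longrightarrow> trace (s x \<zeta>) = c * of_real (g \<zeta>)"
    "((\<lambda>h. g (\<xi> + h *\<^sub>R axis j 1)) has_real_derivative g') (at 0)"
  shows "trace (pd_xi j s x \<xi>) = c * of_real g'"
proof -
  have V: "open (- {0 :: real^4})" by (simp add: open_Compl)
  have "pd_xi j s x \<xi> = vector_derivative (\<lambda>h. f (\<xi> + h *\<^sub>R axis j 1)) (at 0)"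
    by (rule pd_xi_eq[where s = s and f = f, OF assms(1,2)]) (use assms(3) in \<open>simp_all add: vector_derivative_works\<close>)
  then show ?thesis
    using has_trace_vector_derivative[OF assms(3) _ open_line[OF V, of \<xi> "axis j 1"], where c = c and g = "\<lambda>h. g (\<xi> + h *\<^sub>R axis j 1)"]
      assms(1,2,4,5) by simp
qed

lemma axis_component: "axis k c $ i = (if i = k then c else 0)"
  by (simp add: axis_def)

lemma bounded_linear_differentiable:
  "bounded_linear F \<Longrightarrow> f differentiable (at x) \<Longrightarrow> (\<lambda>h. F (f h)) differentiable (at x)"
  unfolding differentiable_def by (blast intro: bounded_linear.has_derivative)

text \<open>
  The trace of the term of order \<open>- 4\<close> is \<open>- 4 s\<close> times this polynomial at \<open>h = a' / a\<close>, \<open>A = a'' / a\<close>, \<open>b = 1 / a\<close>,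
  \<open>c = cot \<eta>\<close>, \<open>t = tan \<eta>\<close>, \<open>s = 1 / P\<close>, \<open>y = \<xi>\<^sub>1\<close>, \<open>z = \<xi>\<^sub>2\<close>. The summands follow the terms of the recursion.
\<close>

definition trace_density :: "real \<Rightarrow> real \<Rightarrow> real \<Rightarrow> real \<Rightarrow> real \<Rightarrow> real \<Rightarrow> real \<Rightarrow> real \<Rightarrow> real \<Rightarrow> real \<Rightarrow> real \<Rightarrow> real \<Rightarrow> real" where
  "trace_density h A b c t s w k k' v y z = (
     let l = 3 * h * y + (c - t) * b\<^sup>2 * z;
         q = y * (- 2 * h * b\<^sup>2 * w) + b\<^sup>2 * z * (b\<^sup>2 * k)
     in s * (- (9 / 4 * h\<^sup>2 + b\<^sup>2 * (c - t)\<^sup>2 / 4) - 3 / 2 * (A - h\<^sup>2) + b\<^sup>2 * (2 + c\<^sup>2 + t\<^sup>2) / 2)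
      - (- 2 * y * s\<^sup>2) * (3 * (A - h\<^sup>2) * y - 2 * h * b\<^sup>2 * (c - t) * z)
      - (- 2 * b\<^sup>2 * z * s\<^sup>2) * (- (2 + c\<^sup>2 + t\<^sup>2) * b\<^sup>2 * z)
      - (8 * y\<^sup>2 * s ^ 3 - 2 * s\<^sup>2) * ((6 * h\<^sup>2 - 2 * A) * b\<^sup>2 * w) / 2
      - (8 * b\<^sup>2 * y * z * s ^ 3) * (- 2 * h * b\<^sup>2 * k)
      - (8 * b ^ 4 * z\<^sup>2 * s ^ 3 - 2 * b\<^sup>2 * s\<^sup>2) * (b\<^sup>2 * k') / 2
      + s\<^sup>2 * (l\<^sup>2 - h\<^sup>2 * b\<^sup>2 * w - b ^ 4 * v) - 2 * s ^ 3 * q * l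
      + (3 * h * s\<^sup>2 - 4 * y * s ^ 3 * l - 2 * s ^ 3 * (- 2 * h * b\<^sup>2 * w) + 12 * y * s ^ 4 * q) * (- 2 * h * b\<^sup>2 * w)
      + ((c - t) * b\<^sup>2 * s\<^sup>2 - 4 * b\<^sup>2 * z * s ^ 3 * l - 2 * s ^ 3 * (b\<^sup>2 * (b\<^sup>2 * k) - 4 * h * b\<^sup>2 * y * z)
          + 12 * b\<^sup>2 * z * s ^ 4 * q) * (b\<^sup>2 * k))"

section \<open>Scalar ingredients of the parametrix and their derivatives\<close>

context robertson_walker
begin

definition S :: "real^4 \<Rightarrow> real^4 \<Rightarrow> real" where "S x \<xi> = inverse (P x \<xi>)"

text \<open>Half of \<open>\<Sum>\<^sub>j \<partial>P/\<partial>\<xi>\<^sub>j \<partial>P/\<partial>x\<^sub>j\<close>.\<close>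

definition Z :: "real^4 \<Rightarrow> real^4 \<Rightarrow> real" where
  "Z x \<xi> = \<xi> $ 1 * (- 2 * hub x * (b x)\<^sup>2 * W x \<xi>) + (b x)\<^sup>2 * \<xi> $ 2 * ((b x)\<^sup>2 * K x \<xi>)"

lemma P_pos:
  assumes "x \<in> U" "\<xi> \<noteq> 0"
  shows "P x \<xi> > 0"
proof -
  have b: "(b x)\<^sup>2 > 0" using assms(1) pos[of "x $ 1"] by (simp add: b_def U_def)
  have c: "1 + (ct x)\<^sup>2 > 0" "1 + (tn x)\<^sup>2 > 0" by (simp_all add: add_pos_nonneg)
  have W: "W x \<xi> \<ge> 0" unfolding W_def using c by (intro add_nonneg_nonneg mult_nonneg_nonneg) auto
  have "P x \<xi> \<ge> 0" unfolding P_def using b W by simp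
  moreover have "P x \<xi> \<noteq> 0"
  proof
    assume "P x \<xi> = 0"
    then have *: "\<xi> $ 1 = 0" "W x \<xi> = 0"
      unfolding P_def using b W by (auto simp: add_nonneg_eq_0_iff)
    then have "(\<xi> $ 2)\<^sup>2 = 0 \<and> (1 + (ct x)\<^sup>2) * (\<xi> $ 3)\<^sup>2 = 0 \<and> (1 + (tn x)\<^sup>2) * (\<xi> $ 4)\<^sup>2 = 0"
      unfolding W_def using c by (subst (asm) add_nonneg_eq_0_iff; (subst (asm) add_nonneg_eq_0_iff)?; simp)
    then have "\<xi> = 0" using * c by (auto simp: vec_eq_iff forall_4)
    then show False using assms(2) by simp
  qed
  ultimately show ?thesis by simp
qed

lemma derivative_W_1: "((\<lambda>h. W (x + h *\<^sub>R axis 1 1) \<xi>) has_real_derivative 0) (at 0)"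
  and derivative_K_1: "((\<lambda>h. K (x + h *\<^sub>R axis 1 1) \<xi>) has_real_derivative 0) (at 0)"
  by (simp_all add: W_def K_def)

lemma derivative_W_2: "((\<lambda>h. W (x + h *\<^sub>R axis 2 1) \<xi>) has_real_derivative K x \<xi>) (at 0)"
  and derivative_K_2: "((\<lambda>h. K (x + h *\<^sub>R axis 2 1) \<xi>) has_real_derivative K' x \<xi>) (at 0)" if "x \<in> U"
  unfolding W_def K_def K'_def
  by (auto intro!: derivative_eq_intros derivative_along_2 that simp: field_simps power2_eq_square)

text \<open>\<open>mpd_x\<close> iterates first derivatives, so the last three facts differentiate
  the values of the first two. The coefficient \<open>6 * (hub x)\<^sup>2 - 2 * acc x\<close> comes
  from the derivatives \<open>- hub * b\<close> of \<open>b\<close> and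
  \<open>acc - hub\<^sup>2\<close> of \<open>hub\<close>.\<close>

lemma derivative_P:
  assumes "x \<in> U"
  shows "((\<lambda>h. P (x + h *\<^sub>R axis 1 1) \<xi>) has_real_derivative - 2 * hub x * (b x)\<^sup>2 * W x \<xi>) (at 0)"
    "((\<lambda>h. P (x + h *\<^sub>R axis 2 1) \<xi>) has_real_derivative (b x)\<^sup>2 * K x \<xi>) (at 0)"
    "((\<lambda>h. - 2 * hub (x + h *\<^sub>R axis 1 1) * (b (x + h *\<^sub>R axis 1 1))\<^sup>2 * W (x + h *\<^sub>R axis 1 1) \<xi>)
       has_real_derivative (6 * (hub x)\<^sup>2 - 2 * acc x) * (b x)\<^sup>2 * W x \<xi>) (at 0)"
    "((\<lambda>h. (b (x + h *\<^sub>R axis 1 1))\<^sup>2 * K (x + h *\<^sub>R axis 1 1) \<xi>)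
       has_real_derivative - 2 * hub x * (b x)\<^sup>2 * K x \<xi>) (at 0)"
    "((\<lambda>h. (b (x + h *\<^sub>R axis 2 1))\<^sup>2 * K (x + h *\<^sub>R axis 2 1) \<xi>)
       has_real_derivative (b x)\<^sup>2 * K' x \<xi>) (at 0)"
  unfolding P_def
  by (auto intro!: derivative_eq_intros derivative_along_1 derivative_W_1 derivative_W_2 derivative_K_1
      derivative_K_2 assms simp: field_simps power2_eq_square)

lemma derivative_L:
  assumes "x \<in> U"
  shows "((\<lambda>h. L (x + h *\<^sub>R axis 1 1) \<xi>) has_real_derivative
      3 * (acc x - (hub x)\<^sup>2) * \<xi> $ 1 - 2 * hub x * (b x)\<^sup>2 * (ct x - tn x) * \<xi> $ 2) (at 0)"
    "((\<lambda>h. L (x + h *\<^sub>R axis 2 1) \<xi>) has_real_derivative - (2 + (ct x)\<^sup>2 + (tn x)\<^sup>2) * (b x)\<^sup>2 * \<xi> $ 2) (at 0)"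
  unfolding L_def
  by (auto intro!: derivative_eq_intros derivative_along_1 derivative_along_2 assms simp: field_simps power2_eq_square)

lemma xi_derivatives:
  "((\<lambda>h. P x (\<xi> + h *\<^sub>R axis 1 1)) has_real_derivative 2 * \<xi> $ 1) (at 0)"
  "((\<lambda>h. P x (\<xi> + h *\<^sub>R axis 2 1)) has_real_derivative 2 * (b x)\<^sup>2 * \<xi> $ 2) (at 0)"
  "((\<lambda>h. L x (\<xi> + h *\<^sub>R axis 1 1)) has_real_derivative 3 * hub x) (at 0)"
  "((\<lambda>h. L x (\<xi> + h *\<^sub>R axis 2 1)) has_real_derivative (ct x - tn x) * (b x)\<^sup>2) (at 0)"
  "((\<lambda>h. Z x (\<xi> + h *\<^sub>R axis 1 1)) has_real_derivative - 2 * hub x * (b x)\<^sup>2 * W x \<xi>) (at 0)"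
  "((\<lambda>h. Z x (\<xi> + h *\<^sub>R axis 2 1)) has_real_derivative
     (b x)\<^sup>2 * ((b x)\<^sup>2 * K x \<xi>) - 4 * hub x * (b x)\<^sup>2 * \<xi> $ 1 * \<xi> $ 2) (at 0)"
  unfolding P_def L_def Z_def W_def K_def
  by (auto intro!: derivative_eq_intros simp: axis_component field_simps power2_eq_square)

lemma xi_derivative_S:
  assumes "x \<in> U" "\<xi> \<noteq> 0"
  shows "((\<lambda>h. S x (\<xi> + h *\<^sub>R axis 1 1)) has_real_derivative - 2 * \<xi> $ 1 * (S x \<xi>)\<^sup>2) (at 0)"
    "((\<lambda>h. S x (\<xi> + h *\<^sub>R axis 2 1)) has_real_derivative - 2 * (b x)\<^sup>2 * \<xi> $ 2 * (S x \<xi>)\<^sup>2) (at 0)"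
  unfolding S_def using P_pos[OF assms]
  by (auto intro!: derivative_eq_intros xi_derivatives simp: field_simps power2_eq_square)

lemma matrix_inv_p2: "matrix_inv (p2 a x \<xi>) = S x \<xi> *\<^sub>R mat 1" if "x \<in> U" "\<xi> \<noteq> 0"
  using P_pos[OF that] by (simp add: p2_eq that matrix_inv_scaleR S_def)

lemma pd_x_p2:
  assumes "x \<in> U"
  shows "pd_x 1 (p2 a) x \<xi> = (- 2 * hub x * (b x)\<^sup>2 * W x \<xi>) *\<^sub>R mat 1"
    "pd_x 2 (p2 a) x \<xi> = ((b x)\<^sup>2 * K x \<xi>) *\<^sub>R mat 1"
  by (rule pd_x_eq[OF open_U assms p2_eq], assumption,
      rule has_vector_derivative_scaleR_const, rule derivative_P, rule assms)+

lemma pd_x_pd_x_p2: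
  assumes "x \<in> U"
  shows "pd_x 1 (pd_x 1 (p2 a)) x \<xi> = ((6 * (hub x)\<^sup>2 - 2 * acc x) * (b x)\<^sup>2 * W x \<xi>) *\<^sub>R mat 1"
    "pd_x 1 (pd_x 2 (p2 a)) x \<xi> = (- 2 * hub x * (b x)\<^sup>2 * K x \<xi>) *\<^sub>R mat 1"
    "pd_x 2 (pd_x 2 (p2 a)) x \<xi> = ((b x)\<^sup>2 * K' x \<xi>) *\<^sub>R mat 1"
  by (rule pd_x_eq[OF open_U assms pd_x_p2(1)] pd_x_eq[OF open_U assms pd_x_p2(2)], assumption,
      rule has_vector_derivative_scaleR_const, rule derivative_P, rule assms)+

lemma parametrix_0_eq: "parametrix a 0 x \<xi> = S x \<xi> *\<^sub>R mat 1" if "x \<in> U" "\<xi> \<noteq> 0"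
  by (simp add: parametrix_0 matrix_inv_p2 that)

lemma pd_xi_parametrix_0:
  assumes "x \<in> U" "\<xi> \<noteq> 0"
  shows "pd_xi 1 (parametrix a 0) x \<xi> = (- 2 * \<xi> $ 1 * (S x \<xi>)\<^sup>2) *\<^sub>R mat 1"
    "pd_xi 2 (parametrix a 0) x \<xi> = (- 2 * (b x)\<^sup>2 * \<xi> $ 2 * (S x \<xi>)\<^sup>2) *\<^sub>R mat 1"
  by (rule pd_xi_eq[OF assms(2) parametrix_0_eq], rule assms, assumption,
      rule has_vector_derivative_scaleR_const, rule xi_derivative_S, rule assms, rule assms)+

lemma pd_xi_pd_xi_parametrix_0:
  assumes "x \<in> U" "\<xi> \<noteq> 0"
  shows "pd_xi 1 (pd_xi 1 (parametrix a 0)) x \<xi> = (8 * (\<xi> $ 1)\<^sup>2 * (S x \<xi>) ^ 3 - 2 * (S x \<xi>)\<^sup>2) *\<^sub>R mat 1"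
    "pd_xi 1 (pd_xi 2 (parametrix a 0)) x \<xi> = (8 * (b x)\<^sup>2 * \<xi> $ 1 * \<xi> $ 2 * (S x \<xi>) ^ 3) *\<^sub>R mat 1"
    "pd_xi 2 (pd_xi 2 (parametrix a 0)) x \<xi> =
       (8 * (b x) ^ 4 * (\<xi> $ 2)\<^sup>2 * (S x \<xi>) ^ 3 - 2 * (b x)\<^sup>2 * (S x \<xi>)\<^sup>2) *\<^sub>R mat 1"
proof -
  have "((\<lambda>h. - 2 * (\<xi> + h *\<^sub>R axis 1 1) $ 1 * (S x (\<xi> + h *\<^sub>R axis 1 1))\<^sup>2)
      has_real_derivative 8 * (\<xi> $ 1)\<^sup>2 * (S x \<xi>) ^ 3 - 2 * (S x \<xi>)\<^sup>2) (at 0)"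
    "((\<lambda>h. - 2 * (b x)\<^sup>2 * (\<xi> + h *\<^sub>R axis 1 1) $ 2 * (S x (\<xi> + h *\<^sub>R axis 1 1))\<^sup>2)
      has_real_derivative 8 * (b x)\<^sup>2 * \<xi> $ 1 * \<xi> $ 2 * (S x \<xi>) ^ 3) (at 0)"
    "((\<lambda>h. - 2 * (b x)\<^sup>2 * (\<xi> + h *\<^sub>R axis 2 1) $ 2 * (S x (\<xi> + h *\<^sub>R axis 2 1))\<^sup>2)
      has_real_derivative 8 * (b x) ^ 4 * (\<xi> $ 2)\<^sup>2 * (S x \<xi>) ^ 3 - 2 * (b x)\<^sup>2 * (S x \<xi>)\<^sup>2) (at 0)"
    by (auto intro!: derivative_eq_intros xi_derivative_S assms simp: axis_component algebra_simps power2_eq_square eval_nat_numeral)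
  note d = this[THEN has_vector_derivative_scaleR_const]
  show "pd_xi 1 (pd_xi 1 (parametrix a 0)) x \<xi> = (8 * (\<xi> $ 1)\<^sup>2 * (S x \<xi>) ^ 3 - 2 * (S x \<xi>)\<^sup>2) *\<^sub>R mat 1"
    by (rule pd_xi_eq[where s = "pd_xi 1 (parametrix a 0)" and x = x, OF assms(2)], rule pd_xi_parametrix_0(1)[OF assms(1)], assumption, rule d(1))
  show "pd_xi 1 (pd_xi 2 (parametrix a 0)) x \<xi> = (8 * (b x)\<^sup>2 * \<xi> $ 1 * \<xi> $ 2 * (S x \<xi>) ^ 3) *\<^sub>R mat 1"
    by (rule pd_xi_eq[where s = "pd_xi 2 (parametrix a 0)" and x = x, OF assms(2)], rule pd_xi_parametrix_0(2)[OF assms(1)], assumption, rule d(2))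
  show "pd_xi 2 (pd_xi 2 (parametrix a 0)) x \<xi> =
       (8 * (b x) ^ 4 * (\<xi> $ 2)\<^sup>2 * (S x \<xi>) ^ 3 - 2 * (b x)\<^sup>2 * (S x \<xi>)\<^sup>2) *\<^sub>R mat 1"
    by (rule pd_xi_eq[where s = "pd_xi 2 (parametrix a 0)" and x = x, OF assms(2)], rule pd_xi_parametrix_0(2)[OF assms(1)], assumption, rule d(3))
qed

section \<open>Traces of the symbols and of the parametrix terms\<close>

lemma trace_p1: "x \<in> U \<Longrightarrow> trace (p1 a x \<xi>) = - 4 * \<i> * of_real (L x \<xi>)"
  by (simp add: p1_eq trace_cscale trace_add trace_sub trace_scaleR trace_bivector trace_one)

lemma trace_p0: "x \<in> U \<Longrightarrow> trace (p0 a x \<xi>) =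
    of_real (4 * (- (9 / 4 * (hub x)\<^sup>2 + (b x)\<^sup>2 * (ct x - tn x)\<^sup>2 / 4) - 3 / 2 * (acc x - (hub x)\<^sup>2)
      + (b x)\<^sup>2 * (2 + (ct x)\<^sup>2 + (tn x)\<^sup>2) / 2))"
  by (simp add: p0_eq trace_add trace_scaleR trace_bivector trace_one)

text \<open>The overall minus sign is \<open>(- \<i>)\<^sup>2\<close>. The bivectors containing
  \<open>g1\<close> add up to the \<open>W\<close> term, \<open>g2 ** g3\<close> and
  \<open>g2 ** g4\<close> to the last bracket.\<close>

lemma trace_p1_square:
  assumes "x \<in> U"
  shows "trace (p1 a x \<xi> ** p1 a x \<xi>) = of_real (- 4 * ((L x \<xi>)\<^sup>2 - (hub x)\<^sup>2 * (b x)\<^sup>2 * W x \<xi>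
    - (b x) ^ 4 * ((ct x)\<^sup>2 * ((1 + (ct x)\<^sup>2) * (\<xi> $ 3)\<^sup>2) + (tn x)\<^sup>2 * ((1 + (tn x)\<^sup>2) * (\<xi> $ 4)\<^sup>2))))"
proof -
  note sq = csc_squared[OF assms] sec_squared[OF assms]
  show ?thesis
    unfolding p1_eq[OF assms] cscale_matrix_mult cscale_simps(5) trace_cscale trace_square
    unfolding W_def power_mult_distrib power2_minus sq
    by (simp add: algebra_simps eval_nat_numeral)
qed

lemma differentiable_along_1:
  assumes "x \<in> U"
  shows "(\<lambda>h. b (x + h *\<^sub>R axis 1 1)) differentiable (at 0)"
    "(\<lambda>h. hub (x + h *\<^sub>R axis 1 1)) differentiable (at 0)"
    "(\<lambda>h. L (x + h *\<^sub>R axis 1 1) \<xi>) differentiable (at 0)"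
  using derivative_along_1[OF assms] derivative_L(1)[OF assms] unfolding real_differentiable_def by blast+

lemma differentiable_along_2:
  assumes "x \<in> U"
  shows "(\<lambda>h. ct (x + h *\<^sub>R axis 2 1)) differentiable (at 0)"
    "(\<lambda>h. tn (x + h *\<^sub>R axis 2 1)) differentiable (at 0)"
    "(\<lambda>h. cs (x + h *\<^sub>R axis 2 1)) differentiable (at 0)"
    "(\<lambda>h. sc (x + h *\<^sub>R axis 2 1)) differentiable (at 0)"
    "(\<lambda>h. L (x + h *\<^sub>R axis 2 1) \<xi>) differentiable (at 0)"
  using derivative_along_2[OF assms] derivative_L(2)[OF assms] unfolding real_differentiable_def by blast+

lemma trace_pd_x_p1:
  assumes "x \<in> U"
  shows "trace (pd_x 1 (p1 a) x \<xi>) = - 4 * \<i> *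
      of_real (3 * (acc x - (hub x)\<^sup>2) * \<xi> $ 1 - 2 * hub x * (b x)\<^sup>2 * (ct x - tn x) * \<xi> $ 2)"
    "trace (pd_x 2 (p1 a) x \<xi>) = - 4 * \<i> * of_real (- (2 + (ct x)\<^sup>2 + (tn x)\<^sup>2) * (b x)\<^sup>2 * \<xi> $ 2)"
proof -
  show "trace (pd_x 1 (p1 a) x \<xi>) = - 4 * \<i> *
      of_real (3 * (acc x - (hub x)\<^sup>2) * \<xi> $ 1 - 2 * hub x * (b x)\<^sup>2 * (ct x - tn x) * \<xi> $ 2)"
    by (rule trace_pd_x_eq[OF open_U assms p1_eq _ trace_p1 derivative_L(1)[OF assms]], assumption)
       (intro bounded_linear_differentiable[OF bounded_linear_cscale] derivative_intros,
        simp_all add: differentiable_along_1 assms)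
  show "trace (pd_x 2 (p1 a) x \<xi>) = - 4 * \<i> * of_real (- (2 + (ct x)\<^sup>2 + (tn x)\<^sup>2) * (b x)\<^sup>2 * \<xi> $ 2)"
    by (rule trace_pd_x_eq[OF open_U assms p1_eq _ trace_p1 derivative_L(2)[OF assms]], assumption)
       (intro bounded_linear_differentiable[OF bounded_linear_cscale] derivative_intros,
        simp_all add: differentiable_along_2 assms)
qed

lemma dirac_sq_symbol_eq:
  "dirac_sq_symbol a 0 = p0 a" "dirac_sq_symbol a 1 = p1 a" "dirac_sq_symbol a 2 = p2 a"
  by (simp_all add: dirac_sq_symbol_def)

lemmas summand_unfold = summand_def mpd_vector mi_abs_vector mi_fact_vector dirac_sq_symbol_eq

text \<open>The \<xi>-gradient of \<open>S\<close> is \<open>- S\<^sup>2\<close> times that of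
  \<open>P\<close>, so the derivative terms pair the two gradients of \<open>P\<close> to
  \<open>2 * Z\<close> and are scalar; all matrix content sits in the multiple of
  \<open>p1\<close>.\<close>

lemma parametrix_1_eq:
  assumes "x \<in> U" "\<xi> \<noteq> 0"
  shows "parametrix a 1 x \<xi> = - ((S x \<xi>)\<^sup>2) *\<^sub>R p1 a x \<xi> + cscale \<i> ((- 2 * (S x \<xi>) ^ 3 * Z x \<xi>) *\<^sub>R mat 1)"
  unfolding parametrix_1 summand_unfold matrix_inv_p2[OF assms] parametrix_0_eq[OF assms]
    pd_xi_parametrix_0[OF assms] pd_x_p2[OF assms(1)] Z_def
  by (simp add: matrix_bilinear cscale_simps)
     (simp add: vec_eq_iff cscale_def scaleR_conv_of_real[where 'a = complex], simp add: algebra_simps power2_eq_square eval_nat_numeral)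

lemma trace_parametrix_1:
  assumes "x \<in> U" "\<xi> \<noteq> 0"
  shows "trace (parametrix a 1 x \<xi>) = 4 * \<i> * of_real ((S x \<xi>)\<^sup>2 * L x \<xi> - 2 * (S x \<xi>) ^ 3 * Z x \<xi>)"
  unfolding parametrix_1_eq[OF assms] trace_add trace_scaleR trace_cscale trace_p1[OF assms(1)] trace_one
  by (simp add: algebra_simps)

lemma differentiable_xi:
  assumes "x \<in> U" "\<xi> \<noteq> 0" "j = 1 \<or> j = 2"
  shows "(\<lambda>h. S x (\<xi> + h *\<^sub>R axis j 1)) differentiable (at 0)"
    "(\<lambda>h. L x (\<xi> + h *\<^sub>R axis j 1)) differentiable (at 0)"
    "(\<lambda>h. Z x (\<xi> + h *\<^sub>R axis j 1)) differentiable (at 0)"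
  using xi_derivatives[of x \<xi>] xi_derivative_S[OF assms(1,2)] assms(3) unfolding real_differentiable_def by blast+

lemma trace_pd_xi_parametrix_1:
  assumes "x \<in> U" "\<xi> \<noteq> 0"
  shows "trace (pd_xi 1 (parametrix a 1) x \<xi>) = 4 * \<i> * of_real
     (3 * hub x * (S x \<xi>)\<^sup>2 - 4 * \<xi> $ 1 * (S x \<xi>) ^ 3 * L x \<xi>
      - 2 * (S x \<xi>) ^ 3 * (- 2 * hub x * (b x)\<^sup>2 * W x \<xi>) + 12 * \<xi> $ 1 * (S x \<xi>) ^ 4 * Z x \<xi>)"
    "trace (pd_xi 2 (parametrix a 1) x \<xi>) = 4 * \<i> * of_real
     ((ct x - tn x) * (b x)\<^sup>2 * (S x \<xi>)\<^sup>2 - 4 * (b x)\<^sup>2 * \<xi> $ 2 * (S x \<xi>) ^ 3 * L x \<xi>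
      - 2 * (S x \<xi>) ^ 3 * ((b x)\<^sup>2 * ((b x)\<^sup>2 * K x \<xi>) - 4 * hub x * (b x)\<^sup>2 * \<xi> $ 1 * \<xi> $ 2)
      + 12 * (b x)\<^sup>2 * \<xi> $ 2 * (S x \<xi>) ^ 4 * Z x \<xi>)"
proof -
  \<comment> \<open>Only the differentiability of this expanded form is used; the derivative itself
    is taken of the formula in \<open>trace_parametrix_1\<close>.\<close>
  have eq: "parametrix a 1 x \<zeta> = - ((S x \<zeta>)\<^sup>2) *\<^sub>R cscale (- \<i>) (L x \<zeta> *\<^sub>R mat 1 + (- (hub x * b x * \<zeta> $ 2)) *\<^sub>R (g1 ** g2)
    + (- (hub x * b x * cs x * \<zeta> $ 3)) *\<^sub>R (g1 ** g3) + (- (hub x * b x * sc x * \<zeta> $ 4)) *\<^sub>R (g1 ** g4)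
    + (- ((b x)\<^sup>2 * cs x * ct x * \<zeta> $ 3)) *\<^sub>R (g2 ** g3) + ((b x)\<^sup>2 * sc x * tn x * \<zeta> $ 4) *\<^sub>R (g2 ** g4))
    + cscale \<i> ((- 2 * (S x \<zeta>) ^ 3 * Z x \<zeta>) *\<^sub>R mat 1)" if "\<zeta> \<noteq> 0" for \<zeta>
    unfolding parametrix_1_eq[OF assms(1) that] p1_eq[OF assms(1)] ..
  show "trace (pd_xi 1 (parametrix a 1) x \<xi>) = 4 * \<i> * of_real
     (3 * hub x * (S x \<xi>)\<^sup>2 - 4 * \<xi> $ 1 * (S x \<xi>) ^ 3 * L x \<xi>
      - 2 * (S x \<xi>) ^ 3 * (- 2 * hub x * (b x)\<^sup>2 * W x \<xi>) + 12 * \<xi> $ 1 * (S x \<xi>) ^ 4 * Z x \<xi>)"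
  proof (rule trace_pd_xi_eq[where s = "parametrix a 1" and x = x, OF assms(2) eq _ trace_parametrix_1[OF assms(1)]])
    show "((\<lambda>h. (S x (\<xi> + h *\<^sub>R axis 1 1))\<^sup>2 * L x (\<xi> + h *\<^sub>R axis 1 1)
        - 2 * (S x (\<xi> + h *\<^sub>R axis 1 1)) ^ 3 * Z x (\<xi> + h *\<^sub>R axis 1 1)) has_real_derivative
      3 * hub x * (S x \<xi>)\<^sup>2 - 4 * \<xi> $ 1 * (S x \<xi>) ^ 3 * L x \<xi>
      - 2 * (S x \<xi>) ^ 3 * (- 2 * hub x * (b x)\<^sup>2 * W x \<xi>) + 12 * \<xi> $ 1 * (S x \<xi>) ^ 4 * Z x \<xi>) (at 0)"
      by (auto intro!: derivative_eq_intros xi_derivatives xi_derivative_S assms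
          simp: algebra_simps power2_eq_square eval_nat_numeral)
  qed (assumption, intro bounded_linear_differentiable[OF bounded_linear_cscale] derivative_intros,
        simp_all add: differentiable_xi assms)
  show "trace (pd_xi 2 (parametrix a 1) x \<xi>) = 4 * \<i> * of_real
     ((ct x - tn x) * (b x)\<^sup>2 * (S x \<xi>)\<^sup>2 - 4 * (b x)\<^sup>2 * \<xi> $ 2 * (S x \<xi>) ^ 3 * L x \<xi>
      - 2 * (S x \<xi>) ^ 3 * ((b x)\<^sup>2 * ((b x)\<^sup>2 * K x \<xi>) - 4 * hub x * (b x)\<^sup>2 * \<xi> $ 1 * \<xi> $ 2)
      + 12 * (b x)\<^sup>2 * \<xi> $ 2 * (S x \<xi>) ^ 4 * Z x \<xi>)"
  proof (rule trace_pd_xi_eq[where s = "parametrix a 1" and x = x, OF assms(2) eq _ trace_parametrix_1[OF assms(1)]])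
    show "((\<lambda>h. (S x (\<xi> + h *\<^sub>R axis 2 1))\<^sup>2 * L x (\<xi> + h *\<^sub>R axis 2 1)
        - 2 * (S x (\<xi> + h *\<^sub>R axis 2 1)) ^ 3 * Z x (\<xi> + h *\<^sub>R axis 2 1)) has_real_derivative
      (ct x - tn x) * (b x)\<^sup>2 * (S x \<xi>)\<^sup>2 - 4 * (b x)\<^sup>2 * \<xi> $ 2 * (S x \<xi>) ^ 3 * L x \<xi>
      - 2 * (S x \<xi>) ^ 3 * ((b x)\<^sup>2 * ((b x)\<^sup>2 * K x \<xi>) - 4 * hub x * (b x)\<^sup>2 * \<xi> $ 1 * \<xi> $ 2)
      + 12 * (b x)\<^sup>2 * \<xi> $ 2 * (S x \<xi>) ^ 4 * Z x \<xi>) (at 0)"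
      by (auto intro!: derivative_eq_intros xi_derivatives xi_derivative_S assms
          simp: algebra_simps power2_eq_square eval_nat_numeral)
  qed (assumption, intro bounded_linear_differentiable[OF bounded_linear_cscale] derivative_intros,
        simp_all add: differentiable_xi assms)
qed

text \<open>For \<open>x\<close> in \<open>U\<close>, \<open>(b x) ^ 4 * V x \<xi>\<close> is the
  sum of the squared real coefficients of \<open>g2 ** g3\<close> and \<open>g2 ** g4\<close> in
  \<open>p1_eq\<close>.\<close>

definition V :: "real^4 \<Rightarrow> real^4 \<Rightarrow> real" where
  "V x \<xi> = (ct x)\<^sup>2 * ((1 + (ct x)\<^sup>2) * (\<xi> $ 3)\<^sup>2) + (tn x)\<^sup>2 * ((1 + (tn x)\<^sup>2) * (\<xi> $ 4)\<^sup>2)"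

lemma trace_parametrix_2:
  assumes "x \<in> U" "\<xi> \<noteq> 0"
  shows "trace (parametrix a 2 x \<xi>) = of_real (- 4 * S x \<xi> *
    trace_density (hub x) (acc x) (b x) (ct x) (tn x) (S x \<xi>) (W x \<xi>) (K x \<xi>) (K' x \<xi>) (V x \<xi>) (\<xi> $ 1) (\<xi> $ 2))"
proof -
  note L' = L_def[of x \<xi>] and Z' = Z_def[of x \<xi>]
  \<comment> \<open>The only summand in which two non-scalar matrices are multiplied.\<close>
  have s11: "trace (parametrix a 1 x \<xi> ** p1 a x \<xi>) = of_real (4 * ((S x \<xi>)\<^sup>2 *
      ((L x \<xi>)\<^sup>2 - (hub x)\<^sup>2 * (b x)\<^sup>2 * W x \<xi> - (b x) ^ 4 * V x \<xi>) - 2 * (S x \<xi>) ^ 3 * Z x \<xi> * L x \<xi>))"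
    unfolding parametrix_1_eq[OF assms] matrix_bilinear trace_add trace_scaleR trace_cscale
      trace_p1_square[OF assms(1)] matrix_mul_lid trace_p1[OF assms(1)] V_def
    by (simp add: algebra_simps)
  show ?thesis
    unfolding parametrix_2 summand_unfold matrix_inv_p2[OF assms] parametrix_0_eq[OF assms]
      pd_xi_parametrix_0[OF assms] pd_xi_pd_xi_parametrix_0[OF assms] pd_x_p2[OF assms(1)] pd_x_pd_x_p2[OF assms(1)]
      matrix_bilinear matrix_mul_lid matrix_mul_rid trace_add trace_scaleR trace_cscale trace_uminus trace_one s11
      trace_p0[OF assms(1)] trace_pd_x_p1[OF assms(1)] trace_pd_xi_parametrix_1[OF assms] trace_density_def Let_def
      L'[symmetric] Z'[symmetric]
  by (simp add: fact_2)
     (simp add: algebra_simps)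
qed

end

section \<open>The even part\<close>

text \<open>
  The arguments \<open>n\<close>, \<open>d\<close>, \<open>dk\<close>, \<open>kk\<close> stand for \<open>csc\<^sup>2 + sec\<^sup>2\<close>, \<open>(cot - tan)\<^sup>2\<close>, \<open>(cot - tan) K\<close> and \<open>K\<^sup>2\<close>, the
  combinations of the odd functions \<open>cot - tan\<close> and \<open>K\<close> that survive the averaging.
\<close>

definition even_density :: "'a::field_char_0 \<Rightarrow> 'a \<Rightarrow> 'a \<Rightarrow> 'a \<Rightarrow> 'a \<Rightarrow> 'a \<Rightarrow> 'a \<Rightarrow> 'a \<Rightarrow> 'a \<Rightarrow> 'a \<Rightarrow> 'a \<Rightarrow> 'a \<Rightarrow> 'a \<Rightarrow> 'a" where
  "even_density h A b n d dk kk k' w v s y z =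
     s * (- (9 / 4 * h\<^sup>2 + b\<^sup>2 * d / 4) - 3 / 2 * (A - h\<^sup>2) + b\<^sup>2 * n / 2)
     + 2 * s\<^sup>2 * (3 * (A - h\<^sup>2) * y\<^sup>2 - n * b ^ 4 * z\<^sup>2)
     - (8 * y\<^sup>2 * s ^ 3 - 2 * s\<^sup>2) * ((6 * h\<^sup>2 - 2 * A) * b\<^sup>2 * w) / 2
     - (8 * b ^ 4 * z\<^sup>2 * s ^ 3 - 2 * b\<^sup>2 * s\<^sup>2) * (b\<^sup>2 * k') / 2
     + s\<^sup>2 * (9 * h\<^sup>2 * y\<^sup>2 + d * b ^ 4 * z\<^sup>2 - h\<^sup>2 * b\<^sup>2 * w - b ^ 4 * v)
     + s\<^sup>2 * (dk * b ^ 4 - 6 * h\<^sup>2 * b\<^sup>2 * w)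
     - 6 * s ^ 3 * (dk * b ^ 6 * z\<^sup>2 - 6 * h\<^sup>2 * b\<^sup>2 * w * y\<^sup>2)
     - 2 * s ^ 3 * (4 * h\<^sup>2 * b ^ 4 * w\<^sup>2 + b ^ 6 * kk)
     + 12 * s ^ 4 * (4 * h\<^sup>2 * b ^ 4 * w\<^sup>2 * y\<^sup>2 + b ^ 8 * kk * z\<^sup>2)"

text \<open>In each monomial of \<open>trace_density\<close> the total degree in
  \<open>c - t\<close>, \<open>k\<close> and \<open>z\<close> is even, so averaging over the sign of
  \<open>z\<close> leaves the odd functions \<open>c - t\<close> and \<open>k\<close> in pairs
  only.\<close>

lemma average_trace_density:
  "(trace_density h A b c t s w k k' v y z + trace_density h A b c t s w k k' v (- y) z
    + trace_density h A b c t s w k k' v y (- z) + trace_density h A b c t s w k k' v (- y) (- z)) / 4 =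
   even_density h A b (2 + c\<^sup>2 + t\<^sup>2) ((c - t)\<^sup>2) ((c - t) * k) (k\<^sup>2) k' w v s y z"
  unfolding trace_density_def even_density_def Let_def
  by (simp add: field_simps eval_nat_numeral)

text \<open>\<open>even_density\<close> is polymorphic so that the real computation carries over to
  the complex points of the target.\<close>

lemma of_real_even_density:
  "of_real (even_density h A b n d dk kk k' w v s y z) =
   (even_density (of_real h) (of_real A) (of_real b) (of_real n) (of_real d) (of_real dk) (of_real kk)
     (of_real k') (of_real w) (of_real v) (of_real s) (of_real y) (of_real z) :: complex)"
  by (simp add: even_density_def)

lemma fractions_divide_numeral:
  assumes "f \<in> fractions"
  shows "(\<lambda>z. f z / numeral n) \<in> fractions"
  using fractions_mult[OF fractions_of_rat[of "1 / numeral n"] assms] by (simp add: of_rat_divide)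

lemmas fractions_intros = fractions_add fractions_diff fractions_uminus fractions_mult fractions_power
  fractions_divide_numeral fractions_numeral fractions_one

lemma fractions_even_density:
  assumes "h \<in> fractions" "A \<in> fractions" "b \<in> fractions" "n \<in> fractions" "d \<in> fractions" "dk \<in> fractions"
    "kk \<in> fractions" "k' \<in> fractions" "w \<in> fractions" "v \<in> fractions" "s \<in> fractions" "y \<in> fractions" "z \<in> fractions"
  shows "(\<lambda>p. even_density (h p) (A p) (b p) (n p) (d p) (dk p) (kk p) (k' p) (w p) (v p) (s p) (y p) (z p)) \<in> fractions"
  unfolding even_density_def by (intro fractions_intros assms)

text \<open>Here \<open>c = 1 / u\<^sub>0 - 1\<close> and \<open>t = 1 / (1 - u\<^sub>0) - 1\<close> are \<open>cot\<^sup>2 \<eta>\<close> and \<open>tan\<^sup>2 \<eta>\<close>.\<close>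

definition dirac_f :: "target \<Rightarrow> complex" where
  "dirac_f = (\<lambda>p. let u = (\<lambda>j. assignment p (Inl j)); \<alpha> = assignment p (Inr 0);
      b = \<alpha> * (case p of (u, \<alpha>, \<alpha>1, \<alpha>2) \<Rightarrow> inverse (\<alpha>\<^sup>2));
      c = (case p of (u, \<alpha>, \<alpha>1, \<alpha>2) \<Rightarrow> inverse (u $ 0)) - 1;
      t = (case p of (u, \<alpha>, \<alpha>1, \<alpha>2) \<Rightarrow> inverse (1 - u $ 0)) - 1;
      s = (case p of (u, \<alpha>, \<alpha>1, \<alpha>2) \<Rightarrow> inverse (quadric \<alpha> u))
    in - (4 * s * even_density (assignment p (Inr 1) * b) (assignment p (Inr 2) * b) b (2 + c + t) (c - 2 + t)
      (2 * ((u 3)\<^sup>2 + (u 4)\<^sup>2) - 2 * (c * (u 3)\<^sup>2 + t * (u 4)\<^sup>2))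
      (4 * (c * u 3 ^ 4 - 2 * (u 3)\<^sup>2 * (u 4)\<^sup>2 + t * u 4 ^ 4))
      ((2 + 6 * c) * (u 3)\<^sup>2 + (2 + 6 * t) * (u 4)\<^sup>2) ((u 2)\<^sup>2 + ((u 3)\<^sup>2 + (u 4)\<^sup>2))
      (c * (u 3)\<^sup>2 + t * (u 4)\<^sup>2) s (u 1) (u 2)))"

lemma dirac_f_in_fractions: "dirac_f \<in> fractions"
  unfolding dirac_f_def Let_def
  by (intro fractions_intros fractions_even_density fractions_var fractions_inverse_alpha2 fractions_inverse_u0
      fractions_inverse_1_minus_u0 fractions_inverse_quadric)

lemma flip_nth: "flip j \<xi> $ i = (if i = j then - \<xi> $ i else \<xi> $ i)"
  by (simp add: flip_def)

lemma flip_nonzero: "\<xi> \<noteq> 0 \<Longrightarrow> flip j \<xi> \<noteq> 0"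
  by (auto simp: vec_eq_iff flip_nth split: if_splits)

context robertson_walker
begin

lemma even_functions_flip:
  "W x (flip j \<xi>) = W x \<xi>" "K x (flip j \<xi>) = K x \<xi>" "K' x (flip j \<xi>) = K' x \<xi>" "V x (flip j \<xi>) = V x \<xi>"
  "S x (flip j \<xi>) = S x \<xi>"
  by (simp_all add: W_def K_def K'_def V_def S_def P_def flip_nth)

lemma b_minus4_eq:
  assumes "x \<in> U" "\<xi> \<noteq> 0"
  shows "b_minus4 a x \<xi> = of_real (- 4 * S x \<xi> * even_density (hub x) (acc x) (b x) (2 + (ct x)\<^sup>2 + (tn x)\<^sup>2)
    ((ct x - tn x)\<^sup>2) ((ct x - tn x) * K x \<xi>) ((K x \<xi>)\<^sup>2) (K' x \<xi>) (W x \<xi>) (V x \<xi>) (S x \<xi>) (\<xi> $ 1) (\<xi> $ 2))"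
proof -
  define D where "D y z = trace_density (hub x) (acc x) (b x) (ct x) (tn x) (S x \<xi>) (W x \<xi>) (K x \<xi>) (K' x \<xi>) (V x \<xi>) y z" for y z
  define T where "T y z = complex_of_real (- 4 * S x \<xi> * D y z)" for y z
  let ?y = "\<xi> $ 1" and ?z = "\<xi> $ 2"
  \<comment> \<open>Of the sixteen sign patterns only the signs of \<open>\<xi> $ 1\<close> and
    \<open>\<xi> $ 2\<close> matter; the other two components enter through squares.\<close>
  have "b_minus4 a x \<xi> = (T ?y ?z + T (- ?y) ?z + T ?y (- ?z) + T (- ?y) (- ?z)) / 4"
    unfolding b_minus4_def even_in_def T_def D_def
    by (simp only: trace_parametrix_2[OF assms(1)] flip_nonzero assms(2) even_functions_flip not_False_eq_True)
       (simp add: flip_nth field_simps)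
  also have "\<dots> = of_real (- 4 * S x \<xi> * ((D ?y ?z + D (- ?y) ?z + D ?y (- ?z) + D (- ?y) (- ?z)) / 4))"
    by (simp add: T_def algebra_simps)
  finally show ?thesis
    unfolding D_def average_trace_density .
qed

lemma dirac_f_change_vars:
  assumes "x \<in> U" "\<xi> \<noteq> 0"
  shows "dirac_f (change_vars a (x $ 1, x $ 2, \<xi>)) = b_minus4 a x \<xi>"
proof -
  define u3 where "u3 = cs x * \<xi> $ 3"
  define u4 where "u4 = sc x * \<xi> $ 4"
  let ?C = "complex_of_real"
  have a: "a (x $ 1) > 0" using assms(1) pos by (simp add: U_def)
  have sin: "sin (x $ 2) \<noteq> 0" and cos: "cos (x $ 2) \<noteq> 0" using trig_pos[OF assms(1)] by auto
  have c: "inverse ((sin (x $ 2))\<^sup>2) - 1 = (ct x)\<^sup>2"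
    using sin by (simp add: ct_def cot_def cos_squared_eq power_divide field_simps)
  have t: "inverse (1 - (sin (x $ 2))\<^sup>2) - 1 = (tn x)\<^sup>2"
    using cos by (simp add: tn_def tan_def sin_squared_eq power_divide field_simps)
  have ct: "ct x * tn x = 1" by (rule cot_times_tan[OF assms(1)])
  have u3: "(1 + (ct x)\<^sup>2) * (\<xi> $ 3)\<^sup>2 = u3\<^sup>2" and u4: "(1 + (tn x)\<^sup>2) * (\<xi> $ 4)\<^sup>2 = u4\<^sup>2"
    by (simp_all add: u3_def u4_def power_mult_distrib csc_squared assms sec_squared)
  have d: "(ct x - tn x)\<^sup>2 = (ct x)\<^sup>2 - 2 + (tn x)\<^sup>2"
    using ct by (simp add: power2_diff)
  \<comment> \<open>Expanding yields mixed products of \<open>ct x\<close> and \<open>tn x\<close>,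
    which reduce to 1; the terms free of both functions, here and in \<open>kk\<close>, arise in
    this way.\<close>
  have dk: "(ct x - tn x) * K x \<xi> = 2 * (u3\<^sup>2 + u4\<^sup>2) - 2 * ((ct x)\<^sup>2 * u3\<^sup>2 + (tn x)\<^sup>2 * u4\<^sup>2)"
    unfolding K_def u3 u4 using ct by algebra
  have kk: "(K x \<xi>)\<^sup>2 = 4 * ((ct x)\<^sup>2 * u3 ^ 4 - 2 * u3\<^sup>2 * u4\<^sup>2 + (tn x)\<^sup>2 * u4 ^ 4)"
    unfolding K_def u3 u4 using ct by algebra
  have W: "W x \<xi> = (\<xi> $ 2)\<^sup>2 + (u3\<^sup>2 + u4\<^sup>2)" unfolding W_def u3 u4 ..
  have V: "V x \<xi> = (ct x)\<^sup>2 * u3\<^sup>2 + (tn x)\<^sup>2 * u4\<^sup>2" unfolding V_def u3 u4 ..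
  have K': "K' x \<xi> = (2 + 6 * (ct x)\<^sup>2) * u3\<^sup>2 + (2 + 6 * (tn x)\<^sup>2) * u4\<^sup>2" unfolding K'_def u3 u4 ..
  have S: "S x \<xi> = inverse ((\<xi> $ 1)\<^sup>2 + inverse ((a (x $ 1))\<^sup>2) * ((\<xi> $ 2)\<^sup>2 + u3\<^sup>2 + u4\<^sup>2))"
    unfolding S_def P_def W by (simp add: b_def inverse_eq_divide power_divide add.assoc)
  have b: "a (x $ 1) * inverse ((a (x $ 1))\<^sup>2) = b x"
    using a by (simp add: b_def field_simps power2_eq_square)
  have hub: "deriv a (x $ 1) * b x = hub x" "deriv (deriv a) (x $ 1) * b x = acc x"
    by (simp_all add: b_def hub_def acc_def)
  have "dirac_f (change_vars a (x $ 1, x $ 2, \<xi>)) =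
    (let u0 = ?C ((sin (x $ 2))\<^sup>2); b = ?C (a (x $ 1) * inverse ((a (x $ 1))\<^sup>2));
      c = ?C (inverse ((sin (x $ 2))\<^sup>2) - 1); t = ?C (inverse (1 - (sin (x $ 2))\<^sup>2) - 1); s = ?C (S x \<xi>)
    in - (4 * s * even_density (?C (deriv a (x $ 1)) * b) (?C (deriv (deriv a) (x $ 1)) * b) b (2 + c + t) (c - 2 + t)
      (2 * ((?C u3)\<^sup>2 + (?C u4)\<^sup>2) - 2 * (c * (?C u3)\<^sup>2 + t * (?C u4)\<^sup>2))
      (4 * (c * ?C u3 ^ 4 - 2 * (?C u3)\<^sup>2 * (?C u4)\<^sup>2 + t * ?C u4 ^ 4))
      ((2 + 6 * c) * (?C u3)\<^sup>2 + (2 + 6 * t) * (?C u4)\<^sup>2) ((?C (\<xi> $ 2))\<^sup>2 + ((?C u3)\<^sup>2 + (?C u4)\<^sup>2))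
      (c * (?C u3)\<^sup>2 + t * (?C u4)\<^sup>2) s (?C (\<xi> $ 1)) (?C (\<xi> $ 2))))"
    unfolding dirac_f_def change_vars_def Let_def S
    by (simp add: assignment_def quadric_def u3_def u4_def cs_def sc_def)
  also have "\<dots> = b_minus4 a x \<xi>"
    unfolding b c t Let_def b_minus4_eq[OF assms] d dk kk K' W V hub[symmetric]
    by (simp add: of_real_even_density)
  finally show ?thesis .
qed

end

theorem theorem4p1:
  shows "\<exists>f \<in> rat_span basic_fractions.
    (\<forall>(a :: real \<Rightarrow> real) I. open I \<and> is_interval I \<and> (\<forall>t\<in>I. a t > 0) \<and> smooth_on_open I a \<longrightarrow>
      (\<forall>t\<in>I. \<forall>\<eta>\<in>{0<..<pi/2}. \<forall>\<xi> :: real^4. \<xi> \<noteq> 0 \<longrightarrow>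
        (\<forall>\<phi>1\<in>{0<..<2*pi}. \<forall>\<phi>2\<in>{0<..<2*pi}. \<forall>vs. length vs = 4 \<longrightarrow>
          b_form a \<phi>1 \<phi>2 (t, \<eta>, \<xi>) vs = pullback (change_vars a) (Omega f) (t, \<eta>, \<xi>) vs))) \<and>
    (\<forall>\<alpha> :: rat. \<alpha> \<noteq> 0 \<longrightarrow>
      zariski_open_over_Q (- (H0 \<union> H1 \<union> CZ \<alpha>)) \<and>
      (\<forall>\<alpha>1 \<alpha>2 :: rat.
        algebraic_form_over_Q 4 (- (H0 \<union> H1 \<union> CZ \<alpha>)) (pullback (slice \<alpha> \<alpha>1 \<alpha>2) (Omega f))))"
\<comment> \<open>\<open>dirac_f\<close> does not mention \<open>a\<close>: the scale factor and its
  derivatives reach it through the last three components of \<open>change_vars\<close>, so one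
  witness serves all scale factors.\<close>
proof (rule bexI[of _ dirac_f], intro conjI allI impI ballI)
  show "dirac_f \<in> rat_span basic_fractions"
    using dirac_f_in_fractions by (simp add: fractions_def)
  fix a :: "real \<Rightarrow> real" and I t \<eta> \<phi>1 \<phi>2 and \<xi> :: "real^4" and vs :: "source list"
  assume a: "open I \<and> is_interval I \<and> (\<forall>t\<in>I. a t > 0) \<and> smooth_on_open I a"
    and t: "t \<in> I" and \<eta>: "\<eta> \<in> {0<..<pi/2}" and \<xi>: "\<xi> \<noteq> 0" and vs: "length vs = 4"
  interpret robertson_walker a I
    using a by unfold_locales auto
  define x :: "real^4" where "x = vector [t, \<eta>, \<phi>1, \<phi>2]"
  have x: "x \<in> U" "x $ 1 = t" "x $ 2 = \<eta>"
    using t \<eta> by (simp_all add: x_def U_def)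
  have "sin \<eta> \<noteq> 0" "cos \<eta> \<noteq> 0"
    using trig_pos[OF x(1)] x(3) by auto
  with pullback_sigma_tilde3[OF differentiable[OF t] _ _ vs, of \<eta> \<xi>]
  have "pullback (change_vars a) sigma_tilde3 (t, \<eta>, \<xi>) vs = wedge1 (differential src_eta) sigma_xi3 (t, \<eta>, \<xi>) vs"
    by blast
  moreover have "dirac_f (change_vars a (t, \<eta>, \<xi>)) = b_minus4 a x \<xi>"
    using dirac_f_change_vars[OF x(1) \<xi>] x by simp
  ultimately show "b_form a \<phi>1 \<phi>2 (t, \<eta>, \<xi>) vs = pullback (change_vars a) (Omega dirac_f) (t, \<eta>, \<xi>) vs"
    by (simp add: b_form_def pullback_def Omega_def x_def)
next
  fix \<alpha> \<alpha>1 \<alpha>2 :: rat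
  assume "\<alpha> \<noteq> 0"
  then show "algebraic_form_over_Q 4 (- (H0 \<union> H1 \<union> CZ \<alpha>)) (pullback (slice \<alpha> \<alpha>1 \<alpha>2) (Omega dirac_f))"
    by (intro algebraic_form_slice dirac_f_in_fractions)
qed (rule zariski_open_complement)

end
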